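(* Let $0<\varepsilon\le 0.04$. Let $\mathcal{A}$ be any randomized $\mathsf{LOCAL}$ algorithm that, for every graph $G=(V,E)$, computes a vertex cover $S\subseteq V$ with $\mathbb{E}[|S|]\le\tau(G)+\varepsilon|V|$, where $\tau(G)$ is the size of a minimum vertex cover of $G$. Then the round complexity of $\mathcal{A}$ is $\Omega\left(\frac{\log n}{\varepsilon}\right)$, where $n=|V|$.
   Context: The $\mathsf{LOCAL}$ model on the graph $G$: synchronous rounds; in each round every vertex receives messages from its neighbours, performs arbitrary local computation and sends arbitrarily large messages to its neighbours; vertices are anonymous and have independent local random bits; the exact number of vertices $n$ is known to all vertices. Each vertex outputs whether it is in $S$. *)

theory Defs
  imports "HOL-Probability.Probability" "Graph_Theory.Pair_Digraph"
begin

text \<open>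
  A finite simple undirected graph is a symmetric, loop-free, finite digraph, i.e. a
  \<^locale>\<open>pair_graph\<close>; the undirected edge \<open>{u, v}\<close> is the pair of arcs \<open>(u, v)\<close>, \<open>(v, u)\<close>.
\<close>

definition neighbours :: "'v pair_pre_digraph \<Rightarrow> 'v \<Rightarrow> 'v set" where
  "neighbours G v = {u. (v, u) \<in> parcs G}"

abbreviation degree_in :: "'v pair_pre_digraph \<Rightarrow> 'v \<Rightarrow> nat" where
  "degree_in G v \<equiv> card (neighbours G v)"

definition vertex_cover :: "'v pair_pre_digraph \<Rightarrow> 'v set \<Rightarrow> bool" where
  "vertex_cover G S \<longleftrightarrow> S \<subseteq> pverts G \<and> (\<forall>(u, v) \<in> parcs G. u \<in> S \<or> v \<in> S)"

definition vertex_cover_number :: "'v pair_pre_digraph \<Rightarrow> nat" where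
  "vertex_cover_number G = Min (card ` {S. vertex_cover G S})"

text \<open>
  Messages are finite bit strings of unbounded length. The memory of a vertex is everything
  it has seen: the number \<open>n\<close> of vertices, its degree, its infinite string of private random
  bits, and the list of message vectors received in the rounds so far, oldest first (the
  \<open>i\<close>-th entry of a message vector came from the neighbour at port \<open>i\<close>). No vertex name is
  passed to an algorithm, so vertices are anonymous. Ports merely let a vertex tell its
  neighbours apart; algorithms that broadcast and treat the received messages as a multiset
  are a special case.
\<close>

type_synonym bits = "nat \<Rightarrow> bool"
type_synonym message = "bool list"
type_synonym history = "message list list"

record algorithm =
  send :: "nat \<Rightarrow> nat \<Rightarrow> bits \<Rightarrow> history \<Rightarrow> nat \<Rightarrow> message"
    \<comment> \<open>\<open>send A n d b h i\<close>: the message for port \<open>i\<close> in the next round\<close>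
  decide :: "nat \<Rightarrow> nat \<Rightarrow> bits \<Rightarrow> history \<Rightarrow> bool option"
    \<comment> \<open>\<open>decide A n d b h\<close>: the output, or \<^const>\<open>None\<close> if the vertex has not decided yet\<close>

definition coin_flips :: "bits measure" where
  "coin_flips = PiM UNIV (\<lambda>_. measure_pmf (bernoulli_pmf (1/2)))"

text \<open>
  Local computation is arbitrary, except that it has to be measurable in the random bits:
  otherwise probabilities and expectations are meaningless.
\<close>

definition randomized_algorithm :: "algorithm \<Rightarrow> bool" where
  "randomized_algorithm A \<longleftrightarrow>
     (\<forall>n d h i. (\<lambda>b. send A n d b h i) \<in> measurable coin_flips (count_space UNIV)) \<and>
     (\<forall>n d h. (\<lambda>b. decide A n d b h) \<in> measurable coin_flips (count_space UNIV))"

text \<open>\<open>p v i\<close> is the neighbour of \<open>v\<close> at port \<open>i\<close>.\<close>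

definition port_numbering :: "'v pair_pre_digraph \<Rightarrow> ('v \<Rightarrow> nat \<Rightarrow> 'v) \<Rightarrow> bool" where
  "port_numbering G p \<longleftrightarrow>
     (\<forall>v \<in> pverts G. bij_betw (p v) {..<degree_in G v} (neighbours G v))"

definition port_to :: "'v pair_pre_digraph \<Rightarrow> ('v \<Rightarrow> nat \<Rightarrow> 'v) \<Rightarrow> 'v \<Rightarrow> 'v \<Rightarrow> nat" where
  "port_to G p u v = the_inv_into {..<degree_in G u} (p u) v"

definition random_bits :: "'v pair_pre_digraph \<Rightarrow> ('v \<Rightarrow> bits) measure" where
  "random_bits G = PiM (pverts G) (\<lambda>_. coin_flips)"

primrec received :: "algorithm \<Rightarrow> 'v pair_pre_digraph \<Rightarrow> ('v \<Rightarrow> nat \<Rightarrow> 'v) \<Rightarrow> ('v \<Rightarrow> bits)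
    \<Rightarrow> nat \<Rightarrow> 'v \<Rightarrow> history" where
  "received A G p \<omega> 0 v = []"
| "received A G p \<omega> (Suc t) v = received A G p \<omega> t v @
     [map (\<lambda>i. let u = p v i in
             send A (card (pverts G)) (degree_in G u) (\<omega> u) (received A G p \<omega> t u)
               (port_to G p u v))
        [0..<degree_in G v]]"

definition decision :: "algorithm \<Rightarrow> 'v pair_pre_digraph \<Rightarrow> ('v \<Rightarrow> nat \<Rightarrow> 'v) \<Rightarrow> ('v \<Rightarrow> bits)
    \<Rightarrow> nat \<Rightarrow> 'v \<Rightarrow> bool option" where
  "decision A G p \<omega> t v =
     decide A (card (pverts G)) (degree_in G v) (\<omega> v) (received A G p \<omega> t v)"

definition decided_within :: "algorithm \<Rightarrow> 'v pair_pre_digraph \<Rightarrow> ('v \<Rightarrow> nat \<Rightarrow> 'v) \<Rightarrow> ('v \<Rightarrow> bits)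
    \<Rightarrow> nat \<Rightarrow> 'v \<Rightarrow> bool" where
  "decided_within A G p \<omega> T v \<longleftrightarrow> (\<exists>t \<le> T. decision A G p \<omega> t v \<noteq> None)"

text \<open>
  The first decision of a vertex is final. Deciding does not stop a vertex from relaying
  messages in later rounds.
\<close>

definition output_set :: "algorithm \<Rightarrow> 'v pair_pre_digraph \<Rightarrow> ('v \<Rightarrow> nat \<Rightarrow> 'v) \<Rightarrow> ('v \<Rightarrow> bits)
    \<Rightarrow> 'v set" where
  "output_set A G p \<omega> = {v \<in> pverts G. \<exists>t. decision A G p \<omega> t v = Some True \<and>
     (\<forall>s<t. decision A G p \<omega> s v = None)}"

text \<open>
  As vertices are anonymous, graphs on \<^typ>\<open>nat\<close> represent all finite graphs. Ports are
  numbered by an adversary.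
\<close>

definition approximates_vertex_cover :: "algorithm \<Rightarrow> real \<Rightarrow> bool" where
  "approximates_vertex_cover A \<epsilon> \<longleftrightarrow>
     (\<forall>(G :: nat pair_pre_digraph) p. pair_graph G \<and> port_numbering G p \<longrightarrow>
        (AE \<omega> in random_bits G.
           (\<forall>v \<in> pverts G. \<exists>T. decided_within A G p \<omega> T v) \<and>
           vertex_cover G (output_set A G p \<omega>)) \<and>
        (\<integral>\<omega>. real (card (output_set A G p \<omega>)) \<partial>random_bits G)
          \<le> real (vertex_cover_number G) + \<epsilon> * real (card (pverts G)))"

text \<open>
  The least number of rounds after which, almost surely, all vertices have decided in every
  graph on \<open>n\<close> vertices, and \<open>\<infinity>\<close> if there is no such number.
\<close>

definition round_complexity :: "algorithm \<Rightarrow> nat \<Rightarrow> enat" where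
  "round_complexity A n = Inf {enat T | T.
     \<forall>(G :: nat pair_pre_digraph) p.
       pair_graph G \<and> card (pverts G) = n \<and> port_numbering G p \<longrightarrow>
         (AE \<omega> in random_bits G. \<forall>v \<in> pverts G. decided_within A G p \<omega> T v)}"

end

theory Submission
  imports Defs
begin

text \<open>
  A sparse random graph with one edge removed from each short odd cycle has \<open>n\<close> vertices, at
  most \<open>32 n\<close> edges, odd girth \<open>\<Omega>(log n)\<close>, and vertex covers far larger than \<open>n / 2\<close>.
  Subdividing every edge \<open>2 k\<close> times with \<open>k = \<Theta>(1 / \<epsilon>)\<close> multiplies the odd girth by
  \<open>2 k + 1\<close>, while the minimum vertex cover still exceeds half of the vertices by more than
  the error that the algorithm is allowed.

  Two disjoint copies of the resulting graph and its bipartite double cover are both 2-lifts of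
  it. As long as the number of rounds is below half of the odd girth, a vertex sees each vertex
  of the base graph at most once in either lift, so it joins \<open>S\<close> with the same probability in
  both. But half of the vertices cover the double cover, whereas two disjoint copies need many
  more.
\<close>

section \<open>Sparse graphs with large odd girth and small independence number\<close>

text \<open>Without subdivision the argument only yields order log n, as the relative gap between
  the two lifts is constant. A path with 2k interior vertices forces k of them into every cover, so
  subdividing adds the same amount to the cover bound and to half of the number of vertices. The
  excess of a cover over half of the vertices stays at least n / 5 per copy, while the number of
  vertices grows by a factor of order k: the relative gap shrinks like 1 / k as the odd girth grows
  like k. This trade is the origin of 1 / \<epsilon>. The two output sizes need not agree run by
  run: two vertices above one base vertex have independent bits. Only the law of a single vertex's
  output is compared, and linearity of expectation needs nothing more. Vertices know the exact
  number of vertices, so the base graph and both lifts are padded with isolated vertices to one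
  common size N, which also covers every large N instead of special sizes.\<close>

definition edge_arcs :: "('i \<Rightarrow> 'v \<times> 'v) \<Rightarrow> 'i set \<Rightarrow> ('v \<times> 'v) set" where
  "edge_arcs f I = f ` I \<union> (f ` I)\<inverse>"

lemma sym_edge_arcs: "sym (edge_arcs f I)"
  by (auto simp: edge_arcs_def sym_def)

lemma edge_arcs_iff: "(x, y) \<in> edge_arcs f I \<longleftrightarrow> (\<exists>i\<in>I. f i = (x, y) \<or> f i = (y, x))"
  by (force simp: edge_arcs_def)

section \<open>Odd closed walks\<close>

lemma relpow_segment:
  assumes "\<And>j. j < r \<Longrightarrow> (w j, w (Suc j)) \<in> R" "a \<le> b" "b \<le> r"
  shows "(w a, w b) \<in> R ^^ (b - a)"
  unfolding relpow_fun_conv using assms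
  by (intro exI[of _ "\<lambda>i. w (a + i)"]) auto

lemma relpow_trans: "(x, y) \<in> R ^^ a \<Longrightarrow> (y, z) \<in> R ^^ b \<Longrightarrow> (x, z) \<in> R ^^ (a + b)"
  by (auto simp: relpow_add)

lemma relpow_sym: "sym R \<Longrightarrow> (x, y) \<in> R ^^ a \<Longrightarrow> (y, x) \<in> R ^^ a"
proof (induction a arbitrary: y)
  case (Suc a)
  then obtain z where "(x, z) \<in> R ^^ a" "(z, y) \<in> R" by auto
  with Suc have "(z, x) \<in> R ^^ a" "(y, z) \<in> R" by (auto dest: symD)
  then show ?case by (meson relpow_Suc_I2)
qed auto

text \<open>A shortest odd closed walk repeats no edge: a repetition would cut it into two shorter
  closed walks, one of them odd. Distinct edge indices matter because a random \<open>f\<close>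
  takes independent values at them.\<close>

lemma odd_closed_walk_contains_edge_simple:
  assumes "odd q" "(x, x) \<in> edge_arcs f I ^^ q"
  obtains r w e where "r \<le> q" "odd r" "w r = w 0" "inj_on e {..<r}"
    "\<And>j. j < r \<Longrightarrow> e j \<in> I \<and> f (e j) \<in> {(w j, w (Suc j)), (w (Suc j), w j)}"
proof -
  define R where "R = edge_arcs f I"
  define P where "P r \<longleftrightarrow> odd r \<and> (\<exists>x. (x, x) \<in> R ^^ r)" for r
  define r where "r = (LEAST r. P r)"
  have "P q" using assms by (auto simp: P_def R_def)
  then have "P r" "r \<le> q" and least: "\<And>s. s < r \<Longrightarrow> \<not> P s"
    unfolding r_def by (auto intro: LeastI Least_le dest: not_less_Least)
  from \<open>P r\<close> obtain w where w: "w r = w 0" "\<And>j. j < r \<Longrightarrow> (w j, w (Suc j)) \<in> R"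
    by (auto simp: P_def relpow_fun_conv)
  have "\<forall>j. \<exists>i. j < r \<longrightarrow> i \<in> I \<and> f i \<in> {(w j, w (Suc j)), (w (Suc j), w j)}"
    using w(2) by (auto simp: R_def edge_arcs_iff)
  then obtain e where e: "\<And>j. j < r \<Longrightarrow> e j \<in> I \<and> f (e j) \<in> {(w j, w (Suc j)), (w (Suc j), w j)}"
    by metis
  have no_repeat: False if "a < b" "b < r" "e a = e b" for a b
  proof -
    have seg: "(w i, w j) \<in> R ^^ (j - i)" if "i \<le> j" "j \<le> r" for i j
      using relpow_segment w(2) that by metis
    have "f (e a) \<in> {(w a, w (Suc a)), (w (Suc a), w a)}" "f (e a) \<in> {(w b, w (Suc b)), (w (Suc b), w b)}"
      using e[of a] e[of b] that by auto
    \<comment> \<open>In the first case the walk is cut at the repeated vertex. In the second the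
      edge is traversed in opposite directions, and dropping both traversals leaves closed walks of
      total length r - 2, which is odd.\<close>
    then consider "w a = w b" | "w a = w (Suc b)" "w (Suc a) = w b" by auto
    then show False
    proof cases
      case 1
      have "(w a, w a) \<in> R ^^ (b - a)" using seg[of a b] that 1 by auto
      moreover have "(w a, w a) \<in> R ^^ ((r - b) + (a - 0))"
        using relpow_trans[OF seg[of b r, unfolded w(1)] seg[of 0 a]] that 1 by auto
      moreover have "b - a < r" "(r - b) + (a - 0) < r" using that by auto
      moreover have "odd (b - a) \<or> odd ((r - b) + (a - 0))"
        using \<open>P r\<close> that by (auto simp: P_def)
      ultimately show False using least unfolding P_def by blast
    next
      case 2
      have "(w b, w b) \<in> R ^^ (b - Suc a)" using seg[of "Suc a" b] that 2 by auto
      moreover have "(w a, w a) \<in> R ^^ ((r - Suc b) + (a - 0))"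
        using relpow_trans[OF seg[of "Suc b" r, unfolded w(1)] seg[of 0 a]] that 2 by auto
      moreover have "b - Suc a < r" "(r - Suc b) + (a - 0) < r" using that by auto
      moreover have "odd (b - Suc a) \<or> odd ((r - Suc b) + (a - 0))"
        using \<open>P r\<close> that by (auto simp: P_def)
      ultimately show False using least unfolding P_def by blast
    qed
  qed
  have "inj_on e {..<r}"
    by (rule inj_onI) (metis lessThan_iff linorder_neqE_nat no_repeat)
  with that \<open>P r\<close> \<open>r \<le> q\<close> w(1) e show ?thesis by (auto simp: P_def)
qed

section \<open>First-moment counting over random edge assignments\<close>

lemma card_PiE_constrained_le:
  assumes "finite I" "finite C" "inj_on e {..<q}" "e ` {..<q} \<subseteq> I"
    and A: "\<And>j. j < q \<Longrightarrow> finite (A j) \<and> card (A j) \<le> b"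
  shows "card {f \<in> I \<rightarrow>\<^sub>E C. \<forall>j<q. f (e j) \<in> A j} \<le> b ^ q * card C ^ (card I - q)"
proof -
  define B where "B i = (if i \<in> e ` {..<q} then A (the_inv_into {..<q} e i) else C)" for i
  have Be: "B (e j) = A j" if "j < q" for j
    using that assms(3) by (auto simp: B_def the_inv_into_f_f)
  have fin: "finite (B i)" if "i \<in> I" for i
    using Be A assms(2) that by (cases "i \<in> e ` {..<q}") (auto simp: B_def the_inv_into_f_f[OF assms(3)])
  have "card {f \<in> I \<rightarrow>\<^sub>E C. \<forall>j<q. f (e j) \<in> A j} \<le> card (PiE I B)"
  proof (rule card_mono)
    show "finite (PiE I B)" using assms(1) fin by (rule finite_PiE)
    have "f i \<in> B i" if "f \<in> I \<rightarrow>\<^sub>E C" "\<forall>j<q. f (e j) \<in> A j" "i \<in> I" for f i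
      using that Be by (cases "i \<in> e ` {..<q}") (auto simp: B_def the_inv_into_f_f[OF assms(3)])
    then show "{f \<in> I \<rightarrow>\<^sub>E C. \<forall>j<q. f (e j) \<in> A j} \<subseteq> PiE I B"
      by (auto simp: PiE_def)
  qed
  also have "\<dots> = (\<Prod>i\<in>e ` {..<q}. card (B i)) * (\<Prod>i\<in>I - e ` {..<q}. card (B i))"
    using assms(1,4) by (simp add: card_PiE prod.subset_diff mult.commute)
  also have "(\<Prod>i\<in>e ` {..<q}. card (B i)) = (\<Prod>j<q. card (A j))"
    using assms(3) Be by (simp add: prod.reindex)
  also have "\<dots> \<le> b ^ q"
    using prod_mono[of "{..<q}" "\<lambda>j. card (A j)" "\<lambda>_. b"] A by simp
  also have "(\<Prod>i\<in>I - e ` {..<q}. card (B i)) = card C ^ (card I - q)"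
    using assms by (simp add: B_def card_Diff_subset card_image)
  finally show ?thesis by (simp add: mult_right_mono)
qed

lemma sum_card_swap:
  assumes "finite A" "finite B"
  shows "(\<Sum>x\<in>A. card {y \<in> B. P x y}) = (\<Sum>y\<in>B. card {x \<in> A. P x y})"
proof -
  have "(\<Sum>x\<in>A. card {y \<in> B. P x y}) = (\<Sum>x\<in>A. \<Sum>y\<in>B. if P x y then 1 else 0)"
    using assms by (intro sum.cong) (simp_all add: sum.If_cases Int_def)
  also have "\<dots> = (\<Sum>y\<in>B. \<Sum>x\<in>A. if P x y then 1 else 0)" by (rule sum.swap)
  also have "\<dots> = (\<Sum>y\<in>B. card {x \<in> A. P x y})"
    using assms by (intro sum.cong) (simp_all add: sum.If_cases Int_def)
  finally show ?thesis .
qed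

text \<open>An edge is identified by its index, so that loops and parallel edges are allowed. The
  index \<open>Suc j mod q\<close> closes the walk without a separate last vertex, and extensional
  functions make the walks countable objects.\<close>

definition edge_simple_closed_walks :: "'v set \<Rightarrow> 'i set \<Rightarrow> ('i \<Rightarrow> 'v \<times> 'v) \<Rightarrow> nat
    \<Rightarrow> ((nat \<Rightarrow> 'v) \<times> (nat \<Rightarrow> 'i)) set" where
  "edge_simple_closed_walks V I f q = {(w, e) \<in> ({..<q} \<rightarrow>\<^sub>E V) \<times> ({..<q} \<rightarrow>\<^sub>E I). inj_on e {..<q} \<and>
     (\<forall>j<q. f (e j) \<in> {(w j, w (Suc j mod q)), (w (Suc j mod q), w j)})}"

lemma finite_edge_simple_closed_walks:
  "finite V \<Longrightarrow> finite I \<Longrightarrow> finite (edge_simple_closed_walks V I f q)"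
  unfolding edge_simple_closed_walks_def
  by (rule finite_subset[of _ "({..<q} \<rightarrow>\<^sub>E V) \<times> ({..<q} \<rightarrow>\<^sub>E I)"]) (auto intro!: finite_PiE)

text \<open>As \<open>card V ^ (2 * card I)\<close> is the number of all \<open>f\<close>, the
  average number of such walks is at most (2D)^q. There are at most |V|^q vertex sequences and
  (D|V|)^q edge sequences, and a fixed pair pins q independent values of \<open>f\<close> to at most
  two of |V|^2 possibilities each.\<close>

lemma sum_card_edge_simple_closed_walks_le:
  assumes "finite V" "finite I" "card I = D * card V"
  shows "(\<Sum>f\<in>I \<rightarrow>\<^sub>E V \<times> V. card (edge_simple_closed_walks V I f q))
    \<le> (2 * D) ^ q * card V ^ (2 * card I)"
proof -
  define C where "C = ({..<q} \<rightarrow>\<^sub>E V) \<times> {e \<in> {..<q} \<rightarrow>\<^sub>E I. inj_on e {..<q}}"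
  define P where "P f c \<longleftrightarrow> (\<forall>j<q. f (snd c j) \<in>
     {(fst c j, fst c (Suc j mod q)), (fst c (Suc j mod q), fst c j)})"
    for f :: "'b \<Rightarrow> 'a \<times> 'a" and c
  have finE: "finite ({..<q} \<rightarrow>\<^sub>E V)" "finite ({..<q} \<rightarrow>\<^sub>E I)" using assms by (auto intro!: finite_PiE)
  then have finC: "finite C" by (auto simp: C_def)
  have finO: "finite (I \<rightarrow>\<^sub>E V \<times> V)" using assms by (auto intro!: finite_PiE)
  have "card {e \<in> {..<q} \<rightarrow>\<^sub>E I. inj_on e {..<q}} \<le> card ({..<q} \<rightarrow>\<^sub>E I)"
    by (rule card_mono[OF finE(2)]) auto
  then have cardC: "card C \<le> card V ^ q * card I ^ q"
    by (simp add: C_def card_cartesian_product card_PiE)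
  have eq1: "(\<Sum>f\<in>I \<rightarrow>\<^sub>E V \<times> V. card (edge_simple_closed_walks V I f q))
      = (\<Sum>f\<in>I \<rightarrow>\<^sub>E V \<times> V. card {c \<in> C. P f c})"
    by (rule sum.cong[OF refl], rule arg_cong[where f = card])
       (auto simp: edge_simple_closed_walks_def C_def P_def)
  have eq2: "(\<Sum>f\<in>I \<rightarrow>\<^sub>E V \<times> V. card {c \<in> C. P f c}) = (\<Sum>c\<in>C. card {f \<in> I \<rightarrow>\<^sub>E V \<times> V. P f c})"
    by (rule sum_card_swap[OF finO finC, of P])
  have "(\<Sum>f\<in>I \<rightarrow>\<^sub>E V \<times> V. card (edge_simple_closed_walks V I f q)) \<le> (\<Sum>c\<in>C. 2 ^ q * (card V * card V) ^ (card I - q))"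
    unfolding eq1 eq2
  proof (rule sum_mono)
    fix c assume c: "c \<in> C"
    define A where "A j = {(fst c j, fst c (Suc j mod q)), (fst c (Suc j mod q), fst c j)}" for j
    have "card {f \<in> I \<rightarrow>\<^sub>E V \<times> V. \<forall>j<q. f (snd c j) \<in> A j} \<le> 2 ^ q * card (V \<times> V) ^ (card I - q)"
    proof (rule card_PiE_constrained_le[where e = "snd c" and A = A and C = "V \<times> V"])
      have "snd c \<in> {..<q} \<rightarrow>\<^sub>E I \<and> inj_on (snd c) {..<q}"
        using c unfolding C_def by force
      then show "inj_on (snd c) {..<q}" "snd c ` {..<q} \<subseteq> I" by blast+
      have "card {a, b} \<le> 2" for a b :: "'a \<times> 'a" by (cases "a = b") auto
      then show "finite (A j) \<and> card (A j) \<le> 2" for j by (simp add: A_def)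
    qed (use assms in auto)
    then show "card {f \<in> I \<rightarrow>\<^sub>E V \<times> V. P f c} \<le> 2 ^ q * (card V * card V) ^ (card I - q)"
      by (simp add: P_def A_def card_cartesian_product)
  qed
  also have "\<dots> = card C * (2 ^ q * (card V * card V) ^ (card I - q))" by simp
  also have "\<dots> \<le> (2 * D) ^ q * card V ^ (2 * card I)"
  \<comment> \<open>If q exceeds \<open>card I\<close>, the subtraction in the exponent is
    truncated, but then no injective \<open>e\<close> exists.\<close>
  proof (cases "q \<le> card I")
    case False
    have "C = {}"
    proof (rule ccontr)
      assume "C \<noteq> {}"
      then obtain e where "e \<in> {..<q} \<rightarrow>\<^sub>E I" "inj_on e {..<q}" by (auto simp: C_def)
      then have "q \<le> card I" using card_inj_on_le[of e "{..<q}" I] assms by auto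
      with False show False by simp
    qed
    then show ?thesis by simp
  next
    case True
    have "card C * (2 ^ q * (card V * card V) ^ (card I - q))
        \<le> (card V ^ q * card I ^ q) * (2 ^ q * (card V * card V) ^ (card I - q))"
      by (intro mult_right_mono cardC) auto
    also have "\<dots> = (2 * D) ^ q * (card V * card V) ^ (q + (card I - q))"
      unfolding power_add by (simp add: assms(3) power_mult_distrib mult_ac)
    also have "\<dots> = (2 * D) ^ q * card V ^ (2 * card I)"
      using True by (simp add: power_mult power2_eq_square)
    finally show ?thesis .
  qed
  finally show ?thesis .
qed

definition large_independent_sets :: "'v set \<Rightarrow> 'i set \<Rightarrow> ('i \<Rightarrow> 'v \<times> 'v) \<Rightarrow> 'v set set" where
  "large_independent_sets V I f = {W \<in> Pow V. card V \<le> 4 * card W \<and> (\<forall>i\<in>I. f i \<notin> W \<times> W)}"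

text \<open>A random pair falls inside a fixed set of at least a quarter of the vertices with
  probability at least 1/16. The union bound over 2^n sets, together with the factor 2^n on the
  left, requires 4 * 15^32 <= 16^32; 32 edges per vertex suffice for this.\<close>

lemma sum_card_large_independent_sets_le:
  assumes "finite V" "finite I" "card I = 32 * card V"
  shows "2 ^ card V * (\<Sum>f\<in>I \<rightarrow>\<^sub>E V \<times> V. card (large_independent_sets V I f)) \<le> card V ^ (2 * card I)"
proof -
  define n where "n = card V"
  define C where "C = {W \<in> Pow V. n \<le> 4 * card W}"
  define P where "P f W \<longleftrightarrow> (\<forall>i\<in>I. f i \<notin> W \<times> W)" for f :: "'b \<Rightarrow> 'a \<times> 'a" and W
  have finC: "finite C" using assms by (auto simp: C_def)
  have finO: "finite (I \<rightarrow>\<^sub>E V \<times> V)" using assms by (auto intro!: finite_PiE)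
  have cardC: "card C \<le> 2 ^ n"
    using card_mono[of "Pow V" C] assms by (auto simp: C_def n_def card_Pow)
  have cnt: "16 ^ card I * card {f \<in> I \<rightarrow>\<^sub>E V \<times> V. P f W} \<le> 15 ^ card I * (n * n) ^ card I"
    if "W \<in> C" for W
  proof -
    have W: "W \<subseteq> V" "n \<le> 4 * card W" using that by (auto simp: C_def)
    have "{f \<in> I \<rightarrow>\<^sub>E V \<times> V. P f W} = I \<rightarrow>\<^sub>E (V \<times> V - W \<times> W)"
      by (auto simp: P_def PiE_def Pi_def)
    then have "card {f \<in> I \<rightarrow>\<^sub>E V \<times> V. P f W} = card (V \<times> V - W \<times> W) ^ card I"
      using assms by (simp add: card_PiE)
    also have "card (V \<times> V - W \<times> W) = n * n - card W * card W"
      using W assms finite_subset[OF W(1)]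
      by (subst card_Diff_subset) (auto simp: card_cartesian_product n_def)
    finally have "16 ^ card I * card {f \<in> I \<rightarrow>\<^sub>E V \<times> V. P f W} = (16 * (n * n - card W * card W)) ^ card I"
      by (simp only: power_mult_distrib)
    also have "\<dots> \<le> (15 * (n * n)) ^ card I"
      using mult_mono[OF W(2) W(2)] by (intro power_mono) auto
    finally show ?thesis by (simp only: power_mult_distrib)
  qed
  define X where "X = (\<Sum>f\<in>I \<rightarrow>\<^sub>E V \<times> V. card (large_independent_sets V I f))"
  have eq1: "X = (\<Sum>f\<in>I \<rightarrow>\<^sub>E V \<times> V. card {W \<in> C. P f W})"
    unfolding X_def
    by (rule sum.cong[OF refl], rule arg_cong[where f = card]) (auto simp: large_independent_sets_def C_def P_def n_def)
  have eq2: "(\<Sum>f\<in>I \<rightarrow>\<^sub>E V \<times> V. card {W \<in> C. P f W}) = (\<Sum>W\<in>C. card {f \<in> I \<rightarrow>\<^sub>E V \<times> V. P f W})"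
    by (rule sum_card_swap[OF finO finC, of P])
  have "16 ^ card I * X = (\<Sum>W\<in>C. 16 ^ card I * card {f \<in> I \<rightarrow>\<^sub>E V \<times> V. P f W})"
    unfolding eq1 eq2 by (simp add: sum_distrib_left)
  also have "\<dots> \<le> (\<Sum>W\<in>C. 15 ^ card I * (n * n) ^ card I)" by (intro sum_mono cnt)
  also have "\<dots> \<le> 2 ^ n * (15 ^ card I * (n * n) ^ card I)"
    by (simp add: cardC mult_right_mono)
  finally have "2 ^ n * (16 ^ card I * X) \<le> 2 ^ n * (2 ^ n * (15 ^ card I * (n * n) ^ card I))"
    by (rule mult_left_mono) simp
  also have "\<dots> = (4 * 15 ^ 32) ^ n * (n * n) ^ card I"
  proof -
    have "(2::nat) ^ n * 2 ^ n = 4 ^ n" by (simp add: power_mult_distrib[symmetric])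
    moreover have "(15::nat) ^ card I = (15 ^ 32) ^ n" unfolding assms(3) n_def by (rule power_mult)
    ultimately show ?thesis unfolding power_mult_distrib by (simp only: mult.assoc[symmetric])
  qed
  also have "\<dots> \<le> (16 ^ 32) ^ n * (n * n) ^ card I"
    by (intro mult_right_mono power_mono) (simp_all only: zero_le, simp)
  also have "(16 ^ 32) ^ n = (16::nat) ^ card I" unfolding assms(3) n_def by (rule power_mult[symmetric])
  finally have "16 ^ card I * (2 ^ n * X) \<le> 16 ^ card I * (n * n) ^ card I" by (simp only: mult_ac)
  then have "2 ^ n * X \<le> (n * n) ^ card I" by simp
  then show ?thesis by (simp add: X_def n_def power_mult power2_eq_square)
qed


lemma exists_few_odd_cycles_no_large_independent_set:
  assumes "finite V" "finite I" "card I = 32 * card V" "80 * 64 ^ L \<le> card V"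
  obtains f where "f \<in> I \<rightarrow>\<^sub>E V \<times> V" "large_independent_sets V I f = {}"
    "20 * (\<Sum>q\<in>{..L}. card (edge_simple_closed_walks V I f q)) \<le> card V"
proof -
  define n where "n = card V"
  define \<Omega> where "\<Omega> = I \<rightarrow>\<^sub>E V \<times> V"
  define ind where "ind f = card (large_independent_sets V I f)" for f :: "'b \<Rightarrow> 'a \<times> 'a"
  define cyc where "cyc f = (\<Sum>q\<in>{..L}. card (edge_simple_closed_walks V I f q))" for f
  have "(1::nat) \<le> 64 ^ L" by simp
  with assms(4) have n: "2 \<le> n" unfolding n_def by linarith
  have card: "card \<Omega> = n ^ (2 * card I)"
    using assms(1,2) by (simp add: \<Omega>_def card_PiE n_def power_mult power2_eq_square)
  have "(4::nat) \<le> 2 ^ n" using power_increasing[OF n, of "2::nat"] by simp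
  then have "4 * sum ind \<Omega> \<le> 2 ^ n * sum ind \<Omega>" by (rule mult_right_mono) simp
  also have "\<dots> \<le> card \<Omega>"
    unfolding card unfolding ind_def \<Omega>_def n_def by (intro sum_card_large_independent_sets_le assms)
  finally have ind: "4 * sum ind \<Omega> \<le> card \<Omega>" .
  have "(\<Sum>q\<in>{..L}. 64 ^ q) \<le> 2 * (64::nat) ^ L" by (induction L) auto
  have "sum cyc \<Omega> = (\<Sum>q\<in>{..L}. \<Sum>f\<in>\<Omega>. card (edge_simple_closed_walks V I f q))"
    unfolding cyc_def by (rule sum.swap)
  also have "\<dots> \<le> (\<Sum>q\<in>{..L}. 64 ^ q * card \<Omega>)"
    unfolding card unfolding \<Omega>_def n_def
    using sum_card_edge_simple_closed_walks_le[OF assms(1-3)] by (intro sum_mono) simp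
  also have "\<dots> = (\<Sum>q\<in>{..L}. 64 ^ q) * card \<Omega>" by (simp add: sum_distrib_right)
  also have "\<dots> \<le> (2 * 64 ^ L) * card \<Omega>"
    by (rule mult_right_mono) (use \<open>(\<Sum>q\<in>{..L}. 64 ^ q) \<le> 2 * 64 ^ L\<close> in auto)
  finally have "40 * sum cyc \<Omega> \<le> (80 * 64 ^ L) * card \<Omega>" by (simp add: mult_ac)
  also have "\<dots> \<le> n * card \<Omega>" using assms(4) by (intro mult_right_mono) (auto simp: n_def)
  finally have cyc: "40 * sum cyc \<Omega> \<le> n * card \<Omega>" .
  have "\<exists>f\<in>\<Omega>. ind f = 0 \<and> 20 * cyc f \<le> n"
  proof (rule ccontr)
    assume neg: "\<not> (\<exists>f\<in>\<Omega>. ind f = 0 \<and> 20 * cyc f \<le> n)"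
    \<comment> \<open>Markov's inequality for both defects at once: the right-hand side is at least
      n for every bad \<open>f\<close>, but its average is at most n / 4 + n / 2.\<close>
    have "n \<le> n * ind f + 20 * cyc f" if "f \<in> \<Omega>" for f
      using neg that by (cases "ind f = 0") (auto intro: order_trans[OF _ le_add1])
    then have "(\<Sum>f\<in>\<Omega>. n) \<le> (\<Sum>f\<in>\<Omega>. n * ind f + 20 * cyc f)" by (rule sum_mono)
    then have "n * card \<Omega> \<le> n * sum ind \<Omega> + 20 * sum cyc \<Omega>"
      by (simp add: sum.distrib mult.commute[of n "card \<Omega>"] flip: sum_distrib_left)
    then have "4 * (n * card \<Omega>) \<le> n * (4 * sum ind \<Omega>) + 80 * sum cyc \<Omega>" by linarith
    moreover have "n * (4 * sum ind \<Omega>) \<le> n * card \<Omega>" by (intro mult_left_mono ind) simp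
    moreover have "0 < n * card \<Omega>" using n by (simp add: card)
    ultimately show False using cyc by linarith
  qed
  then obtain f where f: "f \<in> \<Omega>" "ind f = 0" "20 * cyc f \<le> n" by auto
  have "large_independent_sets V I f = {}"
    using f(2) assms(1) unfolding ind_def large_independent_sets_def by (subst (asm) card_0_eq) auto
  with that f show ?thesis by (simp add: \<Omega>_def cyc_def n_def)
qed

text \<open>The bound on \<open>U\<close> is a robust form of small independence number that
  tolerates edges inside \<open>U\<close> at a price of 1 each. It is needed because a cover of the
  subdivided graph may miss both ends of a base edge. The 3/10 is 1/4 for independent sets plus 1/20
  for removed edges.\<close>

lemma exists_sparse_graph_large_odd_girth_small_independence:
  fixes n L :: nat
  assumes "80 * 64 ^ L \<le> n"
  obtains m and g :: "nat \<Rightarrow> nat \<times> nat" where "m \<le> 32 * n" "g ` {..<m} \<subseteq> {..<n} \<times> {..<n}"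
    "\<And>U. U \<subseteq> {..<n} \<Longrightarrow> 10 * card U \<le> 3 * n + 10 * card {i. i < m \<and> g i \<in> U \<times> U}"
    "\<And>q x. q \<le> L \<Longrightarrow> odd q \<Longrightarrow> (x, x) \<notin> edge_arcs g {..<m} ^^ q"
proof -
  define V where "V = {..<n}"
  define I where "I = {..<32 * n}"
  have fin: "finite V" "finite I" by (auto simp: V_def I_def)
  have "card I = 32 * card V" "80 * 64 ^ L \<le> card V" using assms by (auto simp: V_def I_def)
  with fin obtain f where f: "f \<in> I \<rightarrow>\<^sub>E V \<times> V" "large_independent_sets V I f = {}"
    "20 * (\<Sum>q\<in>{..L}. card (edge_simple_closed_walks V I f q)) \<le> card V"
    by (rule exists_few_odd_cycles_no_large_independent_set)
  \<comment> \<open>The edge at position 0 of every short closed walk is removed, whatever the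
    parity of the length. The empty walk, q = 0, contributes the arbitrary index
    \<open>undefined\<close>, which the bound \<open>f(3)\<close> counts as well.\<close>
  define Del where "Del = (\<Union>q\<in>{..L}. (\<lambda>c. snd c 0) ` edge_simple_closed_walks V I f q)"
  define J where "J = I - Del"
  have finDel: "finite Del"
    unfolding Del_def by (intro finite_UN_I finite_imageI finite_edge_simple_closed_walks fin) auto
  have "card Del \<le> (\<Sum>q\<in>{..L}. card ((\<lambda>c. snd c 0) ` edge_simple_closed_walks V I f q))"
    unfolding Del_def by (rule card_UN_le) simp
  also have "\<dots> \<le> (\<Sum>q\<in>{..L}. card (edge_simple_closed_walks V I f q))"
    by (intro sum_mono card_image_le finite_edge_simple_closed_walks fin)
  finally have cardDel: "20 * card Del \<le> n" using f(3) by (simp add: V_def)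
  have finJ: "finite J" by (simp add: J_def fin)
  \<comment> \<open>The surviving edges are renumbered consecutively because the subdivision places
    the interior of a path according to the index of its edge.\<close>
  from ex_bij_betw_nat_finite[OF finJ] obtain h where h: "bij_betw h {..<card J} J"
    by (auto simp: atLeast0LessThan)
  define g where "g = f \<circ> h"
  have arcs: "edge_arcs g {..<card J} = edge_arcs f J"
    using bij_betw_imp_surj_on[OF h] by (simp only: edge_arcs_def g_def image_comp[symmetric])
  have fV: "f i \<in> V \<times> V" if "i \<in> I" for i using f(1) that by (auto dest: PiE_mem)
  show thesis
  proof (rule that[of "card J" g])
    show "card J \<le> 32 * n" using card_mono[of I J] fin by (auto simp: J_def I_def)
    show "g ` {..<card J} \<subseteq> {..<n} \<times> {..<n}"
    proof (rule image_subsetI)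
      fix i assume "i \<in> {..<card J}"
      then have "h i \<in> I" using bij_betw_apply[OF h] by (simp add: J_def)
      then show "g i \<in> {..<n} \<times> {..<n}" using fV[of "h i"] by (simp add: g_def V_def)
    qed
    show "10 * card U \<le> 3 * n + 10 * card {i. i < card J \<and> g i \<in> U \<times> U}" if U: "U \<subseteq> {..<n}" for U
    proof -
      define Unc where "Unc = {i \<in> J. f i \<in> U \<times> U}"
      have "bij_betw h {i. i < card J \<and> g i \<in> U \<times> U} Unc"
      proof (rule bij_betw_imageI)
        show "inj_on h {i. i < card J \<and> g i \<in> U \<times> U}"
          by (rule inj_on_subset[OF bij_betw_imp_inj_on[OF h]]) auto
        have "Unc = {i \<in> h ` {..<card J}. f i \<in> U \<times> U}"
          using bij_betw_imp_surj_on[OF h] by (simp add: Unc_def)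
        then show "h ` {i. i < card J \<and> g i \<in> U \<times> U} = Unc" by (auto simp: g_def)
      qed
      then have card_Unc: "card {i. i < card J \<and> g i \<in> U \<times> U} = card Unc" by (rule bij_betw_same_card)
      have finU: "finite U" using U finite_subset by auto
      \<comment> \<open>Dropping one end of every surviving edge inside \<open>U\<close> and of
        every removed edge leaves a set that is independent in the original random graph.\<close>
      define X where "X = (fst \<circ> f) ` (Unc \<union> Del)"
      have finX: "finite (Unc \<union> Del)" using finJ finDel by (auto simp: Unc_def)
      have "card X \<le> card (Unc \<union> Del)" unfolding X_def by (intro card_image_le finX)
      also have "\<dots> \<le> card Unc + card Del" by (rule card_Un_le)
      finally have X: "card X \<le> card Unc + card Del" .
      have "\<forall>i\<in>I. f i \<notin> (U - X) \<times> (U - X)"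
        by (force simp: X_def Unc_def J_def)
      then have "n \<le> 4 * card (U - X) \<Longrightarrow> U - X \<in> large_independent_sets V I f"
        using U by (auto simp: large_independent_sets_def V_def)
      with f(2) have "4 * card (U - X) < n" by fastforce
      moreover have "card U \<le> card (U - X) + card X"
        using diff_card_le_card_Diff[of X U] finX by (auto simp: X_def)
      ultimately show ?thesis using X cardDel unfolding card_Unc by linarith
    qed
    show "(x, x) \<notin> edge_arcs g {..<card J} ^^ q" if q: "q \<le> L" "odd q" for q x
    proof
      assume "(x, x) \<in> edge_arcs g {..<card J} ^^ q"
      then have "(x, x) \<in> edge_arcs f J ^^ q" by (simp add: arcs)
      from odd_closed_walk_contains_edge_simple[OF q(2) this] obtain r w e where
        r: "r \<le> q" "odd r" "w r = w 0" "inj_on e {..<r}" and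
        e: "\<And>j. j < r \<Longrightarrow> e j \<in> J \<and> f (e j) \<in> {(w j, w (Suc j)), (w (Suc j), w j)}" by metis
      have r0: "0 < r" using r(2) by (cases r) auto
      have wV: "w j \<in> V" if "j < r" for j
        using e[OF that] fV[of "e j"] by (auto simp: J_def)
      have mod: "w (Suc j mod r) = w (Suc j)" if "j < r" for j
        using that r(3) by (cases "Suc j = r") auto
      have "restrict w {..<r} \<in> {..<r} \<rightarrow>\<^sub>E V" using wV by auto
      moreover have "restrict e {..<r} \<in> {..<r} \<rightarrow>\<^sub>E I" using e by (auto simp: J_def)
      moreover have "inj_on (restrict e {..<r}) {..<r}" using r(4) by (simp add: inj_on_def)
      moreover have "f (restrict e {..<r} j) \<in> {(restrict w {..<r} j, restrict w {..<r} (Suc j mod r)),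
          (restrict w {..<r} (Suc j mod r), restrict w {..<r} j)}" if "j < r" for j
        using e[OF that] mod[OF that] that r0 by simp
      ultimately have "(restrict w {..<r}, restrict e {..<r}) \<in> edge_simple_closed_walks V I f r"
        unfolding edge_simple_closed_walks_def by blast
      then have "snd (restrict w {..<r}, restrict e {..<r}) 0 \<in> Del"
        using r(1) q(1) unfolding Del_def by (intro UN_I[of r] imageI) auto
      with e[OF r0] r0 show False by (simp add: J_def)
    qed
  qed
qed

section \<open>Subdivision\<close>

text \<open>
  Vertex \<open>j\<close> of the path of length \<open>2 * k + 1\<close> that replaces edge \<open>i\<close> of a graph on
  \<open>{..<n}\<close>.
\<close>

definition subdivision_vertex :: "nat \<Rightarrow> nat \<Rightarrow> (nat \<Rightarrow> nat \<times> nat) \<Rightarrow> nat \<Rightarrow> nat \<Rightarrow> nat" where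
  "subdivision_vertex n k g i j =
     (if j = 0 then fst (g i) else if j = 2 * k + 1 then snd (g i) else n + 2 * k * i + (j - 1))"

definition subdivision :: "nat \<Rightarrow> nat \<Rightarrow> nat \<Rightarrow> (nat \<Rightarrow> nat \<times> nat) \<Rightarrow> (nat \<times> nat) set" where
  "subdivision n k m g = edge_arcs
     (\<lambda>(i, j). (subdivision_vertex n k g i j, subdivision_vertex n k g i (Suc j))) ({..<m} \<times> {..2 * k})"

section \<open>Structure of the subdivided graph\<close>

lemma subdivision_step:
  "(x, y) \<in> subdivision n k m g \<longleftrightarrow> (\<exists>i j j'. i < m \<and> j \<le> 2 * k + 1 \<and> j' \<le> 2 * k + 1 \<and>
     (j' = Suc j \<or> j = Suc j') \<and> x = subdivision_vertex n k g i j \<and> y = subdivision_vertex n k g i j')"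
  (is "?l = ?r")
proof
  show "?l \<Longrightarrow> ?r"
    unfolding subdivision_def edge_arcs_iff
    by (elim bexE disjE; clarsimp) (metis Suc_le_mono le_SucI)+
  assume ?r
  then obtain i j j' where *: "i < m" "j \<le> 2 * k + 1" "j' \<le> 2 * k + 1" "j' = Suc j \<or> j = Suc j'"
    "x = subdivision_vertex n k g i j" "y = subdivision_vertex n k g i j'" by blast
  from *(4) show ?l
  proof
    assume "j' = Suc j"
    with * show ?l unfolding subdivision_def edge_arcs_iff by (intro bexI[of _ "(i, j)"]) auto
  next
    assume "j = Suc j'"
    with * show ?l unfolding subdivision_def edge_arcs_iff by (intro bexI[of _ "(i, j')"]) auto
  qed
qed

lemma sym_subdivision: "sym (subdivision n k m g)"
  unfolding subdivision_def by (rule sym_edge_arcs)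

lemma subdivision_arc:
  "i < m \<Longrightarrow> j \<le> 2 * k \<Longrightarrow>
     (subdivision_vertex n k g i j, subdivision_vertex n k g i (Suc j)) \<in> subdivision n k m g"
  unfolding subdivision_def edge_arcs_iff by (intro bexI[of _ "(i, j)"]) auto

lemma subdivision_vertex_interior:
  "j \<noteq> 0 \<Longrightarrow> j \<noteq> 2 * k + 1 \<Longrightarrow> subdivision_vertex n k g i j = n + 2 * k * i + (j - 1)"
  by (simp add: subdivision_vertex_def)

lemma subdivision_vertex_less:
  assumes "g ` {..<m} \<subseteq> {..<n} \<times> {..<n}" "i < m" "j \<le> 2 * k + 1"
  shows "subdivision_vertex n k g i j < n + 2 * k * m"
proof -
  have "g i \<in> {..<n} \<times> {..<n}" using assms by auto
  moreover have "2 * k * i + 2 * k \<le> 2 * k * m"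
    using mult_le_mono2[of "Suc i" m "2 * k"] assms(2) by simp
  ultimately show ?thesis
    using assms(3) by (auto simp: subdivision_vertex_def)
qed

text \<open>Interior vertices are private to their path: after subtracting n, division by 2k
  recovers the path index. Ends are shared by all paths at a base vertex, so nothing more can be
  claimed about them.\<close>

lemma subdivision_vertex_eq_iff:
  assumes "g ` {..<m} \<subseteq> {..<n} \<times> {..<n}" "i < m" "j \<le> 2 * k + 1" "i' < m" "j' \<le> 2 * k + 1"
    "subdivision_vertex n k g i j = subdivision_vertex n k g i' j'"
  shows "(i = i' \<and> j = j') \<or> (j \<in> {0, 2 * k + 1} \<and> j' \<in> {0, 2 * k + 1})"
proof (rule ccontr)
  have end_iff: "subdivision_vertex n k g i j < n \<longleftrightarrow> j \<in> {0, 2 * k + 1}" if "i < m" for i j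
  proof -
    have "g i \<in> {..<n} \<times> {..<n}" using assms(1) that by auto
    then show ?thesis by (auto simp: subdivision_vertex_def)
  qed
  assume neg: "\<not> ?thesis"
  have *: "j \<notin> {0, 2 * k + 1}" "j' \<notin> {0, 2 * k + 1}"
    using neg end_iff[OF assms(2), of j] end_iff[OF assms(4), of j'] assms(6) by auto
  then have eq: "2 * k * i + (j - 1) = 2 * k * i' + (j' - 1)"
    using assms(6) subdivision_vertex_interior[of j k n g i] subdivision_vertex_interior[of j' k n g i'] by auto
  have "j - 1 < 2 * k" "j' - 1 < 2 * k" using * assms by auto
  then have "i = i'" using arg_cong[OF eq, of "\<lambda>x. x div (2 * k)"] by simp
  with eq * neg show False by auto
qed

lemma subdivision_subset:
  assumes "g ` {..<m} \<subseteq> {..<n} \<times> {..<n}"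
  shows "subdivision n k m g \<subseteq> {..<n + 2 * k * m} \<times> {..<n + 2 * k * m}"
  using subdivision_vertex_less[OF assms] by (auto simp: subdivision_step)

text \<open>The edges at odd positions are k disjoint edges between interior vertices. Those at
  positions 0, 2, ..., 2k form a matching of size k + 1, and if both ends are missing, each of them
  needs its own interior vertex. The induction extends the path by two edges instead of naming the
  matchings.\<close>

lemma path_cover_card_ge:
  fixes c :: "nat \<Rightarrow> bool"
  assumes "\<And>j. j \<le> 2 * k \<Longrightarrow> c j \<or> c (Suc j)"
  shows "k + of_bool (\<not> c 0 \<and> \<not> c (2 * k + 1)) \<le> card {j \<in> {1..2 * k}. c j}"
  using assms
proof (induction k)
  case 0
  then show ?case using 0[of 0] by auto
next
  case (Suc k)
  let ?C = "{j \<in> {1..2 * k}. c j}"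
  have of_bool_card: "card {j. j = l \<and> c j} = of_bool (c l)" for l
  proof -
    have "{j. j = l \<and> c j} = (if c l then {l} else {})" by auto
    then show ?thesis by simp
  qed
  let ?X = "{j. j = 2 * k + 1 \<and> c j}" and ?Y = "{j. j = 2 * k + 2 \<and> c j}"
  have split: "{j \<in> {1..2 * Suc k}. c j} = ?C \<union> (?X \<union> ?Y)"
    by (auto simp: le_Suc_eq)
  have "card (?C \<union> (?X \<union> ?Y)) = card ?C + card (?X \<union> ?Y)"
    by (rule card_Un_disjoint) auto
  moreover have "card (?X \<union> ?Y) = card ?X + card ?Y"
    by (rule card_Un_disjoint) auto
  ultimately have card: "card {j \<in> {1..2 * Suc k}. c j} = card ?C + (of_bool (c (2 * k + 1)) + of_bool (c (2 * k + 2)))"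
    by (simp only: split of_bool_card)
  have IH: "k + of_bool (\<not> c 0 \<and> \<not> c (2 * k + 1)) \<le> card ?C" using Suc by auto
  have "c (2 * k + 1) \<or> c (2 * k + 2)" "c (2 * k + 2) \<or> c (2 * Suc k + 1)"
    using Suc.prems[of "2 * k + 1"] Suc.prems[of "2 * k + 2"] by auto
  with IH show ?case unfolding card
    by (cases "c 0"; cases "c (2 * k + 1)"; cases "c (2 * k + 2)"; cases "c (2 * Suc k + 1)") auto
qed

text \<open>A base edge with both ends outside \<open>S\<close> costs one additional interior
  vertex. Paths are added one at a time; each occupies its own interval of numbers, so the
  contributions add up.\<close>

lemma subdivision_cover_card_ge:
  assumes g: "g ` {..<m} \<subseteq> {..<n} \<times> {..<n}"
    and cover: "\<And>x y. (x, y) \<in> subdivision n k m g \<Longrightarrow> x \<in> S \<or> y \<in> S"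
  shows "card (S \<inter> {..<n}) + k * m + card {i. i < m \<and> g i \<in> ({..<n} - S) \<times> ({..<n} - S)}
    \<le> card (S \<inter> {..<n + 2 * k * m})"
proof -
  have "card (S \<inter> {..<n}) + k * l + card {i. i < l \<and> g i \<in> ({..<n} - S) \<times> ({..<n} - S)}
      \<le> card (S \<inter> {..<n + 2 * k * l})" if "l \<le> m" for l
    using that
  proof (induction l)
    case (Suc l)
    let ?U = "{..<n} - S"
    have gl: "g l \<in> {..<n} \<times> {..<n}" using g Suc.prems by auto
    let ?v = "\<lambda>j. subdivision_vertex n k g l j"
    have "k + of_bool (\<not> ?v 0 \<in> S \<and> \<not> ?v (2 * k + 1) \<in> S) \<le> card {j \<in> {1..2 * k}. ?v j \<in> S}"
      by (rule path_cover_card_ge, rule cover, rule subdivision_arc) (use Suc.prems in auto)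
    also have "(\<not> ?v 0 \<in> S \<and> \<not> ?v (2 * k + 1) \<in> S) \<longleftrightarrow> g l \<in> ?U \<times> ?U"
      using gl by (cases "g l") (auto simp: subdivision_vertex_def)
    also have "card {j \<in> {1..2 * k}. ?v j \<in> S} \<le> card (S \<inter> {n + 2 * k * l..<n + 2 * k * Suc l})"
      by (rule card_inj_on_le[of ?v])
         (auto simp: inj_on_def subdivision_vertex_interior)
    finally have new: "k + of_bool (g l \<in> ?U \<times> ?U) \<le> card (S \<inter> {n + 2 * k * l..<n + 2 * k * Suc l})" .
    have split: "{i. i < Suc l \<and> g i \<in> ?U \<times> ?U} = {i. i < l \<and> g i \<in> ?U \<times> ?U} \<union> {i. i = l \<and> g i \<in> ?U \<times> ?U}"
      by (auto simp: less_Suc_eq)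
    have "card {i. i < Suc l \<and> g i \<in> ?U \<times> ?U}
        = card {i. i < l \<and> g i \<in> ?U \<times> ?U} + card {i. i = l \<and> g i \<in> ?U \<times> ?U}"
      unfolding split by (rule card_Un_disjoint) auto
    also have "card {i. i = l \<and> g i \<in> ?U \<times> ?U} = of_bool (g l \<in> ?U \<times> ?U)"
    proof -
      have "{i. i = l \<and> g i \<in> ?U \<times> ?U} = (if g l \<in> ?U \<times> ?U then {l} else {})" by auto
      then show ?thesis by simp
    qed
    finally have unc: "card {i. i < Suc l \<and> g i \<in> ?U \<times> ?U}
      = card {i. i < l \<and> g i \<in> ?U \<times> ?U} + of_bool (g l \<in> ?U \<times> ?U)" .
    have split: "S \<inter> {..<n + 2 * k * Suc l} = (S \<inter> {..<n + 2 * k * l}) \<union> (S \<inter> {n + 2 * k * l..<n + 2 * k * Suc l})"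
      by auto
    have "card (S \<inter> {..<n + 2 * k * Suc l})
        = card (S \<inter> {..<n + 2 * k * l}) + card (S \<inter> {n + 2 * k * l..<n + 2 * k * Suc l})"
      unfolding split by (rule card_Un_disjoint) auto
    moreover have "card (S \<inter> {..<n}) + k * l + card {i. i < l \<and> g i \<in> ?U \<times> ?U} \<le> card (S \<inter> {..<n + 2 * k * l})"
      using Suc by simp
    ultimately show ?case using new unc unfolding mult_Suc_right by linarith
  qed simp
  then show ?thesis by simp
qed

text \<open>Contracting each traversed path to its base edge preserves parity because 2k + 1 is odd.
  The slack of 2(2k + 1) pays for moving the start of the walk to a base vertex, where the invariant
  below has to begin.\<close>

lemma odd_closed_walk_of_subdivision:
  assumes g: "g ` {..<m} \<subseteq> {..<n} \<times> {..<n}"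
    and walk: "(x, x) \<in> subdivision n k m g ^^ l" "odd l"
  obtains q u where "odd q" "q * (2 * k + 1) \<le> l + 2 * (2 * k + 1)" "(u, u) \<in> edge_arcs g {..<m} ^^ q"
proof -
  let ?R = "subdivision n k m g" and ?B = "edge_arcs g {..<m}" and ?v = "subdivision_vertex n k g"
  text \<open>
    A walk of length \<open>l\<close> from \<open>u\<close> to position \<open>j\<close> of path \<open>i\<close> comes from a walk in the base
    graph to an end of that path, up to detours of even length.
  \<close>
  define near where "near u i j l \<longleftrightarrow>
      (\<exists>q. (u, fst (g i)) \<in> ?B ^^ q \<and> q * (2 * k + 1) + j \<le> l \<and> even (q + j + l)) \<or>
      (\<exists>q. (u, snd (g i)) \<in> ?B ^^ q \<and> q * (2 * k + 1) + (2 * k + 1 - j) \<le> l \<and> even (q + (2 * k + 1 - j) + l))"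
    for u i j l
  have arc: "(fst (g i), snd (g i)) \<in> ?B" "(snd (g i), fst (g i)) \<in> ?B" if "i < m" for i
    using that by (metis edge_arcs_iff lessThan_iff prod.collapse)+
  \<comment> \<open>At an end of a path both alternatives collapse into one that mentions only the
    vertex: being a full path length away from the opposite end amounts to one more base
    step.\<close>
  have near_end: "near u i j l \<longleftrightarrow> (\<exists>q. (u, ?v i j) \<in> ?B ^^ q \<and> q * (2 * k + 1) \<le> l \<and> even (q + l))"
    if ij: "i < m" "j \<in> {0, 2 * k + 1}" for u i j l
  proof
    assume "near u i j l"
    then consider
        q where "(u, fst (g i)) \<in> ?B ^^ q" "q * (2 * k + 1) + j \<le> l" "even (q + j + l)"
      | q where "(u, snd (g i)) \<in> ?B ^^ q" "q * (2 * k + 1) + (2 * k + 1 - j) \<le> l" "even (q + (2 * k + 1 - j) + l)"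
      by (auto simp: near_def)
    then show "\<exists>q. (u, ?v i j) \<in> ?B ^^ q \<and> q * (2 * k + 1) \<le> l \<and> even (q + l)"
    proof cases
      case 1
      show ?thesis
      proof (cases "j = 0")
        case True
        with 1 show ?thesis by (intro exI[of _ q]) (auto simp: subdivision_vertex_def)
      next
        case False
        then have "j = 2 * k + 1" using ij by auto
        with 1 relpow_Suc_I[OF 1(1) arc(1)[OF ij(1)]] show ?thesis
          by (intro exI[of _ "Suc q"]) (auto simp: subdivision_vertex_def)
      qed
    next
      case 2
      show ?thesis
      proof (cases "j = 0")
        case True
        with 2 relpow_Suc_I[OF 2(1) arc(2)[OF ij(1)]] show ?thesis
          by (intro exI[of _ "Suc q"]) (auto simp: subdivision_vertex_def)
      next
        case False
        then have "j = 2 * k + 1" using ij by auto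
        with 2 show ?thesis by (intro exI[of _ q]) (auto simp: subdivision_vertex_def)
      qed
    qed
  next
    assume "\<exists>q. (u, ?v i j) \<in> ?B ^^ q \<and> q * (2 * k + 1) \<le> l \<and> even (q + l)"
    then obtain q where "(u, ?v i j) \<in> ?B ^^ q" "q * (2 * k + 1) \<le> l" "even (q + l)" by auto
    then show "near u i j l"
      using ij unfolding near_def by (auto simp: subdivision_vertex_def intro!: exI[of _ q])
  qed
  \<comment> \<open>A walk can change paths only at a base vertex, where by \<open>near_end\<close>
    the invariant no longer depends on the path.\<close>
  have near_transfer: "near u i' j' l"
    if "near u i j l" "?v i j = ?v i' j'" "i < m" "j \<le> 2 * k + 1" "i' < m" "j' \<le> 2 * k + 1" for u i j i' j' l
    using subdivision_vertex_eq_iff[OF g that(3-6,2)]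
  proof
    assume "j \<in> {0, 2 * k + 1} \<and> j' \<in> {0, 2 * k + 1}"
    then show ?thesis using that near_end by metis
  qed (use that in auto)
  have near_step: "near u i j' (Suc l)"
    if near: "near u i j l" and j: "j \<le> 2 * k + 1" "j' \<le> 2 * k + 1" "j' = Suc j \<or> j = Suc j'" for u i j j' l
    using near unfolding near_def
  proof (elim disjE exE)
    fix q assume "(u, fst (g i)) \<in> ?B ^^ q \<and> q * (2 * k + 1) + j \<le> l \<and> even (q + j + l)"
    moreover from this have "q * (2 * k + 1) + j' \<le> Suc l" "even (q + j' + Suc l)" using j by auto
    ultimately show "(\<exists>q. (u, fst (g i)) \<in> ?B ^^ q \<and> q * (2 * k + 1) + j' \<le> Suc l \<and> even (q + j' + Suc l)) \<or>
      (\<exists>q. (u, snd (g i)) \<in> ?B ^^ q \<and> q * (2 * k + 1) + (2 * k + 1 - j') \<le> Suc l \<and> even (q + (2 * k + 1 - j') + Suc l))"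
      by blast
  next
    fix q assume *: "(u, snd (g i)) \<in> ?B ^^ q \<and> q * (2 * k + 1) + (2 * k + 1 - j) \<le> l \<and>
      even (q + (2 * k + 1 - j) + l)"
    \<comment> \<open>Seen from the far end the step again changes the distance by one; the bounds
      on \<open>j\<close> and \<open>j'\<close> keep the natural subtraction exact.\<close>
    define r r' where "r = 2 * k + 1 - j" and "r' = 2 * k + 1 - j'"
    have "r = Suc r' \<or> r' = Suc r" using j by (auto simp: r_def r'_def)
    moreover have "q * (2 * k + 1) + r \<le> l" "even (q + r + l)" unfolding r_def using * by blast+
    ultimately have "q * (2 * k + 1) + r' \<le> Suc l" "even (q + r' + Suc l)" by auto
    with * show "(\<exists>q. (u, fst (g i)) \<in> ?B ^^ q \<and> q * (2 * k + 1) + j' \<le> Suc l \<and> even (q + j' + Suc l)) \<or>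
      (\<exists>q. (u, snd (g i)) \<in> ?B ^^ q \<and> q * (2 * k + 1) + (2 * k + 1 - j') \<le> Suc l \<and> even (q + (2 * k + 1 - j') + Suc l))"
      unfolding r'_def by blast
  qed
  have near: "near u i j l" if "(u, y) \<in> ?R ^^ l" "u < n" "i < m" "j \<le> 2 * k + 1" "y = ?v i j" for u y i j l
    using that
  proof (induction l arbitrary: y i j)
    case 0
    then have "j \<in> {0, 2 * k + 1}"
      by (auto simp: subdivision_vertex_def split: if_splits)
    with 0 show ?case using near_end[of i j] by (auto intro!: exI[of _ 0])
  next
    case (Suc l)
    then obtain z where z: "(u, z) \<in> ?R ^^ l" "(z, y) \<in> ?R" by auto
    then obtain i' a b where *: "i' < m" "a \<le> 2 * k + 1" "b \<le> 2 * k + 1" "b = Suc a \<or> a = Suc b"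
      "z = ?v i' a" "y = ?v i' b" unfolding subdivision_step by blast
    have "near u i' b (Suc l)"
      using near_step[OF Suc.IH[OF z(1) Suc.prems(2) *(1,2,5)] *(2-4)] .
    then show ?case by (rule near_transfer) (use * Suc.prems in auto)
  qed
  obtain l' where "l = Suc l'" using walk(2) by (cases l) auto
  then obtain y where "(y, x) \<in> ?R" using walk(1) by auto
  then obtain i j where ij: "i < m" "j \<le> 2 * k + 1" "x = ?v i j" unfolding subdivision_step by blast
  \<comment> \<open>The closed walk is conjugated by the initial segment of the path through
    \<open>x\<close>, so that it starts at the base vertex \<open>u\<close>. This adds 2j to its
    length.\<close>
  define u where "u = ?v i 0"
  have to_x: "(u, ?v i b) \<in> ?R ^^ b" if "b \<le> 2 * k + 1" for b
    using that
  proof (induction b)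
    case (Suc b)
    then have "(?v i b, ?v i (Suc b)) \<in> ?R" using ij(1) by (intro subdivision_arc) auto
    with Suc show ?case by auto
  qed (simp add: u_def)
  have "(u, x) \<in> ?R ^^ j" using to_x ij by simp
  moreover from this have "(x, u) \<in> ?R ^^ j" by (rule relpow_sym[OF sym_subdivision])
  ultimately have "(u, u) \<in> ?R ^^ (j + (l + j))" using walk(1) by (intro relpow_trans)
  moreover have "u < n" using g ij(1) by (force simp: u_def subdivision_vertex_def)
  ultimately have "near u i 0 (j + (l + j))" using near[of u u _ i 0] ij u_def by auto
  then obtain q where q: "(u, u) \<in> ?B ^^ q" "q * (2 * k + 1) \<le> j + (l + j)" "even (q + (j + (l + j)))"
    using near_end[of i 0 u] ij(1) unfolding u_def by auto
  have "odd q" using q(3) walk(2) by presburger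
  moreover have "q * (2 * k + 1) \<le> l + 2 * (2 * k + 1)" 
    using ij(2) by (intro order_trans[OF q(2)]) simp
  ultimately show thesis using q(1) by (rule that)
qed

section \<open>Locality and coverings\<close>

lemma space_coin_flips [simp]: "space coin_flips = UNIV"
  by (simp add: coin_flips_def space_PiM)

lemma prob_space_coin_flips: "prob_space coin_flips"
  unfolding coin_flips_def by (intro prob_space_PiM) (simp add: measure_pmf.prob_space_axioms)

lemma prob_space_random_bits: "prob_space (random_bits G)"
  unfolding random_bits_def by (intro prob_space_PiM prob_space_coin_flips)

lemma port_in_neighbours:
  assumes "port_numbering G p" "v \<in> pverts G" "i < degree_in G v"
  shows "p v i \<in> neighbours G v"
  using assms bij_betw_apply[of "p v" "{..<degree_in G v}"] by (auto simp: port_numbering_def)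

lemma neighbours_subset_pverts: "pair_wf_digraph G \<Longrightarrow> neighbours G v \<subseteq> pverts G"
  by (auto simp: neighbours_def pair_wf_digraph.in_arcsD2)

text \<open>Information crosses one edge per round. Graph and ports are fixed here and only the bits
  vary, which makes the history a function of the bits in the ball.\<close>

lemma received_cong_ball:
  assumes "pair_wf_digraph G" "port_numbering G p" "v \<in> pverts G"
    and "\<And>k y. k \<le> t \<Longrightarrow> (v, y) \<in> parcs G ^^ k \<Longrightarrow> \<omega> y = \<omega>' y"
  shows "received A G p \<omega> t v = received A G p \<omega>' t v"
  using assms(3,4)
proof (induction t arbitrary: v)
  case (Suc t)
  have "received A G p \<omega> t v = received A G p \<omega>' t v"
    by (rule Suc.IH[OF Suc.prems(1)]) (rule Suc.prems(2)[OF le_SucI])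
  moreover have "\<omega> (p v i) = \<omega>' (p v i) \<and> received A G p \<omega> t (p v i) = received A G p \<omega>' t (p v i)"
    if "i < degree_in G v" for i
  proof
    have nb: "p v i \<in> neighbours G v" using port_in_neighbours[OF assms(2) Suc.prems(1) that] .
    then have arc: "(v, p v i) \<in> parcs G" by (simp add: neighbours_def)
    then show "\<omega> (p v i) = \<omega>' (p v i)" by (intro Suc.prems(2)[of 1]) auto
    show "received A G p \<omega> t (p v i) = received A G p \<omega>' t (p v i)"
    proof (rule Suc.IH)
      show "p v i \<in> pverts G" using nb neighbours_subset_pverts[OF assms(1)] by auto
      show "\<omega> y = \<omega>' y" if "k \<le> t" "(p v i, y) \<in> parcs G ^^ k" for k y
        using that relpow_Suc_I2[OF arc] by (intro Suc.prems(2)[of "Suc k"]) auto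
    qed
  qed
  ultimately show ?case by (simp add: Let_def)
qed simp

text \<open>\<open>output_set\<close> looks at unboundedly many rounds. Its truncation at
  \<open>T\<close> is determined by the bits in a ball of radius \<open>T\<close> and agrees with it
  at every vertex that has decided by then.\<close>

definition accepts_within :: "algorithm \<Rightarrow> 'v pair_pre_digraph \<Rightarrow> ('v \<Rightarrow> nat \<Rightarrow> 'v) \<Rightarrow> nat
    \<Rightarrow> ('v \<Rightarrow> bits) \<Rightarrow> 'v \<Rightarrow> bool" where
  "accepts_within A G p T \<omega> v \<longleftrightarrow>
     (\<exists>t\<le>T. decision A G p \<omega> t v = Some True \<and> (\<forall>s<t. decision A G p \<omega> s v = None))"

lemma accepts_within_cong_ball:
  assumes "pair_wf_digraph G" "port_numbering G p" "v \<in> pverts G"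
    and "\<And>k y. k \<le> T \<Longrightarrow> (v, y) \<in> parcs G ^^ k \<Longrightarrow> \<omega> y = \<omega>' y"
  shows "accepts_within A G p T \<omega> v \<longleftrightarrow> accepts_within A G p T \<omega>' v"
proof -
  have "decision A G p \<omega> t v = decision A G p \<omega>' t v" if "t \<le> T" for t
  proof -
    have "received A G p \<omega> t v = received A G p \<omega>' t v"
      by (rule received_cong_ball[OF assms(1-3)]) (rule assms(4)[OF order_trans[OF _ that]])
    then show ?thesis using assms(4)[of 0 v] by (simp add: decision_def)
  qed
  then have "(decision A G p \<omega> t v = Some True \<and> (\<forall>s<t. decision A G p \<omega> s v = None)) \<longleftrightarrow>
      (decision A G p \<omega>' t v = Some True \<and> (\<forall>s<t. decision A G p \<omega>' s v = None))" if "t \<le> T" for t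
    using that by auto
  then show ?thesis unfolding accepts_within_def by blast
qed

lemma output_set_eq_accepts_within:
  assumes "decided_within A G p \<omega> T v" "v \<in> pverts G"
  shows "v \<in> output_set A G p \<omega> \<longleftrightarrow> accepts_within A G p T \<omega> v"
proof
  assume "v \<in> output_set A G p \<omega>"
  then obtain t where t: "decision A G p \<omega> t v = Some True" "\<forall>s<t. decision A G p \<omega> s v = None"
    by (auto simp: output_set_def)
  from assms(1) obtain t' where "t' \<le> T" "decision A G p \<omega> t' v \<noteq> None" by (auto simp: decided_within_def)
  with t(2) have "t \<le> T" by (metis le_trans not_le)
  with t show "accepts_within A G p T \<omega> v" by (auto simp: accepts_within_def)
qed (use assms in \<open>auto simp: accepts_within_def output_set_def\<close>)

section \<open>Measurability of histories, decisions and outputs\<close>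

lemma measurable_map_list:
  fixes f :: "'a \<Rightarrow> 'b \<Rightarrow> 'c::countable"
  assumes "\<And>x. x \<in> set xs \<Longrightarrow> f x \<in> M \<rightarrow>\<^sub>M count_space UNIV"
  shows "(\<lambda>\<omega>. map (\<lambda>x. f x \<omega>) xs) \<in> M \<rightarrow>\<^sub>M count_space UNIV"
  using assms
proof (induction xs)
  case (Cons x xs)
  have "(\<lambda>\<omega>. a # map (\<lambda>x. f x \<omega>) xs) \<in> M \<rightarrow>\<^sub>M count_space UNIV" for a
    by (rule measurable_compose[OF Cons.IH]) (use Cons.prems in auto)
  then have "(\<lambda>\<omega>. f x \<omega> # map (\<lambda>x. f x \<omega>) xs) \<in> M \<rightarrow>\<^sub>M count_space UNIV"
    by (rule measurable_compose_countable) (use Cons.prems in auto)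
  then show ?case by simp
qed simp

lemma measurable_random_bit_string:
  "v \<in> pverts G \<Longrightarrow> (\<lambda>\<omega>. \<omega> v) \<in> random_bits G \<rightarrow>\<^sub>M coin_flips"
  unfolding random_bits_def by (rule measurable_component_singleton)

text \<open>Histories form a countable type, so the random history can be split into its possible
  values. At each fixed history, \<open>send\<close> is measurable in the bits by
  assumption.\<close>

lemma measurable_received:
  assumes "randomized_algorithm A" "pair_wf_digraph G" "port_numbering G p" "v \<in> pverts G"
  shows "(\<lambda>\<omega>. received A G p \<omega> t v) \<in> random_bits G \<rightarrow>\<^sub>M count_space UNIV"
  using assms(4)
proof (induction t arbitrary: v)
  case (Suc t)
  let ?M = "random_bits G"
  have "(\<lambda>\<omega>. send A (card (pverts G)) (degree_in G (p v i)) (\<omega> (p v i)) (received A G p \<omega> t (p v i))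
      (port_to G p (p v i) v)) \<in> ?M \<rightarrow>\<^sub>M count_space UNIV" if "i < degree_in G v" for i
  proof (rule measurable_compose_countable[where g = "\<lambda>\<omega>. received A G p \<omega> t (p v i)"])
    have u: "p v i \<in> pverts G"
      using port_in_neighbours[OF assms(3) Suc.prems that] neighbours_subset_pverts[OF assms(2)] by auto
    then show "(\<lambda>\<omega>. received A G p \<omega> t (p v i)) \<in> ?M \<rightarrow>\<^sub>M count_space UNIV" by (rule Suc.IH)
    show "(\<lambda>\<omega>. send A (card (pverts G)) (degree_in G (p v i)) (\<omega> (p v i)) h (port_to G p (p v i) v))
        \<in> ?M \<rightarrow>\<^sub>M count_space UNIV" for h
      by (rule measurable_compose[OF measurable_random_bit_string[OF u]])
         (use assms(1) in \<open>simp add: randomized_algorithm_def\<close>)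
  qed
  then have "(\<lambda>\<omega>. map (\<lambda>i. send A (card (pverts G)) (degree_in G (p v i)) (\<omega> (p v i)) (received A G p \<omega> t (p v i))
      (port_to G p (p v i) v)) [0..<degree_in G v]) \<in> ?M \<rightarrow>\<^sub>M count_space UNIV" (is "?m \<in> _")
    by (intro measurable_map_list) auto
  then have "(\<lambda>\<omega>. h @ [?m \<omega>]) \<in> ?M \<rightarrow>\<^sub>M count_space UNIV" for h
    by (rule measurable_compose) simp
  then have "(\<lambda>\<omega>. received A G p \<omega> t v @ [?m \<omega>]) \<in> ?M \<rightarrow>\<^sub>M count_space UNIV"
    by (rule measurable_compose_countable) (rule Suc.IH[OF Suc.prems])
  then show ?case by (simp add: Let_def)
qed simp

lemma measurable_decision:
  assumes "randomized_algorithm A" "pair_wf_digraph G" "port_numbering G p" "v \<in> pverts G"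
  shows "(\<lambda>\<omega>. decision A G p \<omega> t v) \<in> random_bits G \<rightarrow>\<^sub>M count_space UNIV"
  unfolding decision_def
proof (rule measurable_compose_countable[where g = "\<lambda>\<omega>. received A G p \<omega> t v"])
  show "(\<lambda>\<omega>. received A G p \<omega> t v) \<in> random_bits G \<rightarrow>\<^sub>M count_space UNIV"
    by (rule measurable_received[OF assms])
  show "(\<lambda>\<omega>. decide A (card (pverts G)) (degree_in G v) (\<omega> v) h) \<in> random_bits G \<rightarrow>\<^sub>M count_space UNIV" for h
    by (rule measurable_compose[OF measurable_random_bit_string[OF assms(4)]])
       (use assms(1) in \<open>simp add: randomized_algorithm_def\<close>)
qed

lemma measurable_accepts_within:
  assumes "randomized_algorithm A" "pair_wf_digraph G" "port_numbering G p" "v \<in> pverts G"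
  shows "Measurable.pred (random_bits G) (\<lambda>\<omega>. accepts_within A G p T \<omega> v)"
proof -
  note [measurable] = measurable_decision[OF assms]
  show ?thesis unfolding accepts_within_def by measurable
qed

lemma measurable_output_set:
  assumes "randomized_algorithm A" "pair_wf_digraph G" "port_numbering G p" "v \<in> pverts G"
  shows "Measurable.pred (random_bits G) (\<lambda>\<omega>. v \<in> output_set A G p \<omega>)"
proof -
  note [measurable] = measurable_decision[OF assms]
  show ?thesis unfolding output_set_def mem_Collect_eq by measurable
qed

text \<open>A covering map that respects ports: given port numberings, it maps the neighbours of
  \<open>x\<close> bijectively to those of its image. It need not be onto, which allows the padded
  base graph to have as many vertices as its lifts.\<close>

definition port_covering :: "'u pair_pre_digraph \<Rightarrow> ('u \<Rightarrow> nat \<Rightarrow> 'u) \<Rightarrow> 'v pair_pre_digraph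
    \<Rightarrow> ('v \<Rightarrow> nat \<Rightarrow> 'v) \<Rightarrow> ('u \<Rightarrow> 'v) \<Rightarrow> bool" where
  "port_covering H q G p \<phi> \<longleftrightarrow> (\<forall>x \<in> pverts H. \<phi> x \<in> pverts G \<and>
     degree_in H x = degree_in G (\<phi> x) \<and> (\<forall>i<degree_in H x. \<phi> (q x i) = p (\<phi> x) i))"

lemma port_to_covering:
  assumes "port_numbering H q" "port_numbering G p" "port_covering H q G p \<phi>"
    and "y \<in> pverts H" "x \<in> neighbours H y"
  shows "port_to H q y x = port_to G p (\<phi> y) (\<phi> x)"
proof -
  have bij: "bij_betw (q y) {..<degree_in H y} (neighbours H y)"
    using assms by (auto simp: port_numbering_def)
  then obtain j where j: "j < degree_in H y" "q y j = x"
    using assms(5) by (metis bij_betw_imp_surj_on imageE lessThan_iff)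
  have "\<phi> x = p (\<phi> y) j" "degree_in H y = degree_in G (\<phi> y)" "\<phi> y \<in> pverts G"
    using assms(3,4) j by (auto simp: port_covering_def)
  moreover from this have "inj_on (p (\<phi> y)) {..<degree_in G (\<phi> y)}"
    using assms(2) by (auto simp: port_numbering_def bij_betw_def)
  ultimately have "port_to G p (\<phi> y) (\<phi> x) = j"
    using j(1) by (simp add: port_to_def the_inv_into_f_f)
  moreover have "port_to H q y x = j"
    using bij j by (auto simp: port_to_def bij_betw_def the_inv_into_f_f)
  ultimately show ?thesis by simp
qed

text \<open>With bits pulled back along the covering, a vertex cannot be told from its image. The
  vertex counts must agree because the count is an argument of \<open>send\<close>.\<close>

lemma received_covering:
  assumes H: "pair_graph H" "port_numbering H q" and G: "port_numbering G p"
    and cov: "port_covering H q G p \<phi>" and card: "card (pverts H) = card (pverts G)"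
    and x: "x \<in> pverts H"
  shows "received A H q (\<lambda>y. \<eta> (\<phi> y)) t x = received A G p \<eta> t (\<phi> x)"
  using x
proof (induction t arbitrary: x)
  case (Suc t)
  interpret H: pair_graph H by fact
  have deg: "degree_in H x = degree_in G (\<phi> x)" using cov Suc.prems by (auto simp: port_covering_def)
  have "send A (card (pverts H)) (degree_in H (q x i)) (\<eta> (\<phi> (q x i))) (received A H q (\<lambda>y. \<eta> (\<phi> y)) t (q x i))
          (port_to H q (q x i) x)
      = send A (card (pverts G)) (degree_in G (p (\<phi> x) i)) (\<eta> (p (\<phi> x) i)) (received A G p \<eta> t (p (\<phi> x) i))
          (port_to G p (p (\<phi> x) i) (\<phi> x))" if i: "i < degree_in H x" for i
  proof -
    have nb: "q x i \<in> neighbours H x" using port_in_neighbours[OF H(2) Suc.prems i] .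
    then have "(x, q x i) \<in> parcs H" by (simp add: neighbours_def)
    moreover from this have "(q x i, x) \<in> parcs H" by (rule H.arcs_symmetric)
    ultimately have y: "q x i \<in> pverts H" "x \<in> neighbours H (q x i)"
      by (auto simp: neighbours_def H.in_arcsD2)
    have \<phi>: "\<phi> (q x i) = p (\<phi> x) i" using cov Suc.prems i by (auto simp: port_covering_def)
    have "degree_in H (q x i) = degree_in G (p (\<phi> x) i)" using cov y(1) \<phi> by (auto simp: port_covering_def)
    then show ?thesis
      using Suc.IH[OF y(1)] port_to_covering[OF H(2) G cov y] by (simp add: \<phi> card)
  qed
  then show ?case using Suc.IH[OF Suc.prems] deg by (simp add: Let_def)
qed simp

lemma accepts_within_covering:
  assumes "pair_graph H" "port_numbering H q" "port_numbering G p"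
    and "port_covering H q G p \<phi>" "card (pverts H) = card (pverts G)" "x \<in> pverts H"
  shows "accepts_within A H q T (\<lambda>y. \<eta> (\<phi> y)) x \<longleftrightarrow> accepts_within A G p T \<eta> (\<phi> x)"
proof -
  have "degree_in H x = degree_in G (\<phi> x)" using assms by (auto simp: port_covering_def)
  then show ?thesis
    unfolding accepts_within_def decision_def received_covering[OF assms] assms(5) by simp
qed

lemma measure_PiM_reindex:
  assumes "prob_space N" "inj_on f J" "f \<in> J \<rightarrow> K" "Q \<in> sets (PiM J (\<lambda>_. N))"
  shows "measure (PiM K (\<lambda>_. N)) {\<omega> \<in> space (PiM K (\<lambda>_. N)). (\<lambda>j\<in>J. \<omega> (f j)) \<in> Q}
    = measure (PiM J (\<lambda>_. N)) Q"
proof -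
  let ?g = "\<lambda>\<omega>. \<lambda>j\<in>J. \<omega> (f j)"
  have meas: "?g \<in> PiM K (\<lambda>_. N) \<rightarrow>\<^sub>M PiM J (\<lambda>_. N)"
    using assms(3) by (intro measurable_restrict measurable_component_singleton) auto
  have "measure (PiM J (\<lambda>_. N)) Q = measure (distr (PiM K (\<lambda>_. N)) (PiM J (\<lambda>_. N)) ?g) Q"
    using distr_PiM_reindex[OF assms(1) assms(2,3)] by simp
  also have "\<dots> = measure (PiM K (\<lambda>_. N)) (?g -` Q \<inter> space (PiM K (\<lambda>_. N)))"
    by (rule measure_distr[OF meas assms(4)])
  also have "?g -` Q \<inter> space (PiM K (\<lambda>_. N)) = {\<omega> \<in> space (PiM K (\<lambda>_. N)). ?g \<omega> \<in> Q}" by auto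
  finally show ?thesis by simp
qed

lemma relpow_in_pverts:
  assumes "pair_wf_digraph G" "v \<in> pverts G" "(v, y) \<in> parcs G ^^ k"
  shows "y \<in> pverts G"
  using assms(2,3) by (induction k arbitrary: y) (auto simp: pair_wf_digraph.in_arcsD2[OF assms(1)])

text \<open>Pulled-back bits coincide on a fibre, whereas the true bits are independent. Inside a
  ball that meets each fibre at most once the difference is invisible: its bits have the same
  product law either way, and \<open>T\<close> rounds see nothing else.\<close>

lemma prob_accepts_within_covering:
  assumes A: "randomized_algorithm A"
    and H: "pair_graph H" "port_numbering H q" and G: "port_numbering G p"
    and cov: "port_covering H q G p \<phi>" and card: "card (pverts H) = card (pverts G)"
    and x: "x \<in> pverts H"
    and inj: "inj_on \<phi> {y. \<exists>k\<le>T. (x, y) \<in> parcs H ^^ k}"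
  shows "measure (random_bits H) {\<omega> \<in> space (random_bits H). accepts_within A H q T \<omega> x}
    = measure (random_bits G) {\<eta> \<in> space (random_bits G). accepts_within A G p T \<eta> (\<phi> x)}"
proof -
  interpret H: pair_graph H by fact
  have wf: "pair_wf_digraph H" ..
  define J where "J = {y. \<exists>k\<le>T. (x, y) \<in> parcs H ^^ k}"
  have J: "J \<subseteq> pverts H" using relpow_in_pverts[OF wf x] by (auto simp: J_def)
  let ?M = "PiM J (\<lambda>_. coin_flips)"
  \<comment> \<open>Fixing the bits outside the ball to \<open>False\<close> turns acceptance at
    \<open>x\<close> into an event \<open>Q\<close> about the bits of the ball alone.\<close>
  define ext where "ext \<zeta> = (\<lambda>y\<in>pverts H. if y \<in> J then \<zeta> y else (\<lambda>_. False))" for \<zeta> :: "'a \<Rightarrow> bits"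
  have ext: "ext \<in> ?M \<rightarrow>\<^sub>M random_bits H"
    unfolding ext_def random_bits_def
  proof (rule measurable_restrict)
    fix y assume "y \<in> pverts H"
    show "(\<lambda>\<zeta>. if y \<in> J then \<zeta> y else (\<lambda>_. False)) \<in> ?M \<rightarrow>\<^sub>M coin_flips"
      by (cases "y \<in> J") (auto intro: measurable_component_singleton)
  qed
  define Q where "Q = {\<zeta> \<in> space ?M. accepts_within A H q T (ext \<zeta>) x}"
  have Q: "Q \<in> sets ?M"
    unfolding Q_def
    using measurable_compose[OF ext measurable_accepts_within[OF A wf H(2) x, of T]]
    by (rule predE)
  have Q_iff: "(\<lambda>j\<in>J. \<xi> j) \<in> Q \<longleftrightarrow> accepts_within A H q T \<xi> x" for \<xi>
  proof -
    have "accepts_within A H q T (ext (\<lambda>j\<in>J. \<xi> j)) x \<longleftrightarrow> accepts_within A H q T \<xi> x"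
    proof (rule accepts_within_cong_ball[OF wf H(2) x])
      show "ext (\<lambda>j\<in>J. \<xi> j) y = \<xi> y" if "k \<le> T" "(x, y) \<in> parcs H ^^ k" for k y
      proof -
        have "y \<in> J" using that by (auto simp: J_def)
        with J show ?thesis by (auto simp: ext_def)
      qed
    qed
    then show ?thesis by (simp add: Q_def space_PiM)
  qed
  have "measure (random_bits H) {\<omega> \<in> space (random_bits H). accepts_within A H q T \<omega> x} = measure ?M Q"
    using measure_PiM_reindex[OF prob_space_coin_flips, of id J "pverts H" Q] J Q Q_iff
    by (simp add: random_bits_def subset_iff)
  moreover have "\<phi> \<in> J \<rightarrow> pverts G" using J cov by (auto simp: port_covering_def)
  \<comment> \<open>Since \<open>\<phi>\<close> is injective on the ball, reading base bits along it
    draws independent bit strings indexed by \<open>J\<close>, and \<open>Q\<close> keeps its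
    probability.\<close>
  then have "measure (random_bits G) {\<eta> \<in> space (random_bits G). accepts_within A G p T \<eta> (\<phi> x)} = measure ?M Q"
    using measure_PiM_reindex[OF prob_space_coin_flips inj[folded J_def] _ Q, of "pverts G"]
      Q_iff accepts_within_covering[OF H G cov card x]
    by (simp add: random_bits_def)
  ultimately show ?thesis by simp
qed

section \<open>Expected size of the output\<close>

lemma card_output_set_eq_sum:
  assumes "finite (pverts G)"
  shows "real (card (output_set A G p \<omega>)) = (\<Sum>v\<in>pverts G. of_bool (v \<in> output_set A G p \<omega>))"
proof -
  have "output_set A G p \<omega> = {v \<in> pverts G. v \<in> output_set A G p \<omega>}" by (auto simp: output_set_def)
  then show ?thesis using assms by (simp add: of_bool_def sum.If_cases Int_def)
qed

text \<open>Linearity of expectation reduces the size of the output to probabilities at single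
  vertices, which are all that coverings compare.\<close>

lemma expected_card_output_set:
  assumes A: "randomized_algorithm A" and G: "pair_graph G" "port_numbering G p"
    and dec: "AE \<omega> in random_bits G. \<forall>v \<in> pverts G. decided_within A G p \<omega> T v"
  shows "(\<integral>\<omega>. real (card (output_set A G p \<omega>)) \<partial>random_bits G)
    = (\<Sum>v\<in>pverts G. measure (random_bits G) {\<omega> \<in> space (random_bits G). accepts_within A G p T \<omega> v})"
proof -
  interpret G: pair_graph G by fact
  interpret prob_space "random_bits G" by (rule prob_space_random_bits)
  let ?M = "random_bits G"
  have wf: "pair_wf_digraph G" ..
  have fin: "finite (pverts G)" by (rule G.pair_finite_verts)
  have m1: "(\<lambda>\<omega>. of_bool (v \<in> output_set A G p \<omega>) :: real) \<in> borel_measurable ?M"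
    if "v \<in> pverts G" for v
    using measurable_output_set[OF A wf G(2) that] by measurable
  have m2: "(\<lambda>\<omega>. of_bool (accepts_within A G p T \<omega> v) :: real) \<in> borel_measurable ?M"
    if "v \<in> pverts G" for v
    using measurable_accepts_within[OF A wf G(2) that] by measurable
  have int: "integrable ?M (\<lambda>\<omega>. of_bool (accepts_within A G p T \<omega> v) :: real)"
    if "v \<in> pverts G" for v
    by (rule integrable_const_bound[of _ 1]) (use m2[OF that] in auto)
  have "(\<integral>\<omega>. real (card (output_set A G p \<omega>)) \<partial>?M)
      = (\<integral>\<omega>. (\<Sum>v\<in>pverts G. of_bool (accepts_within A G p T \<omega> v)) \<partial>?M)"
    unfolding card_output_set_eq_sum[OF fin]
  proof (rule integral_cong_AE)
    show "AE \<omega> in ?M. (\<Sum>v\<in>pverts G. of_bool (v \<in> output_set A G p \<omega>) :: real)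
        = (\<Sum>v\<in>pverts G. of_bool (accepts_within A G p T \<omega> v))"
      using dec
    proof eventually_elim
      case (elim \<omega>)
      then have "v \<in> output_set A G p \<omega> \<longleftrightarrow> accepts_within A G p T \<omega> v" if "v \<in> pverts G" for v
        using that by (intro output_set_eq_accepts_within) auto
      then show ?case by (intro sum.cong) auto
    qed
  qed (rule borel_measurable_sum, erule m1, rule borel_measurable_sum, erule m2)
  also have "\<dots> = (\<Sum>v\<in>pverts G. \<integral>\<omega>. of_bool (accepts_within A G p T \<omega> v) \<partial>?M)"
    by (rule Bochner_Integration.integral_sum) (rule int)
  also have "\<dots> = (\<Sum>v\<in>pverts G. measure ?M {\<omega> \<in> space ?M. accepts_within A G p T \<omega> v})"
  proof (rule sum.cong[OF refl])
    fix v assume "v \<in> pverts G"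
    then have "{\<omega> \<in> space ?M. accepts_within A G p T \<omega> v} \<in> sets ?M"
      using measurable_accepts_within[OF A wf G(2)] by (intro predE)
    moreover have "(\<integral>\<omega>. of_bool (accepts_within A G p T \<omega> v) \<partial>?M)
        = (\<integral>\<omega>. indicator {\<omega> \<in> space ?M. accepts_within A G p T \<omega> v} \<omega> \<partial>?M :: real)"
      by (rule Bochner_Integration.integral_cong) (auto simp: indicator_def)
    ultimately show "(\<integral>\<omega>. of_bool (accepts_within A G p T \<omega> v) \<partial>?M)
        = measure ?M {\<omega> \<in> space ?M. accepts_within A G p T \<omega> v}"
      by (simp add: Int_absorb1)
  qed
  finally show ?thesis .
qed

text \<open>Integrability has to be checked: the Bochner integral of a non-integrable function is 0,
  which would break the lower bound.\<close>

lemma expected_card_output_set_ge: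
  assumes A: "randomized_algorithm A" and G: "pair_graph G" "port_numbering G p"
    and cover: "AE \<omega> in random_bits G. vertex_cover G (output_set A G p \<omega>)"
    and K: "\<And>S. vertex_cover G S \<Longrightarrow> K \<le> card S"
  shows "real K \<le> (\<integral>\<omega>. real (card (output_set A G p \<omega>)) \<partial>random_bits G)"
proof -
  interpret G: pair_graph G by fact
  interpret prob_space "random_bits G" by (rule prob_space_random_bits)
  have wf: "pair_wf_digraph G" ..
  have fin: "finite (pverts G)" by (rule G.pair_finite_verts)
  have m1: "(\<lambda>\<omega>. of_bool (v \<in> output_set A G p \<omega>) :: real) \<in> borel_measurable (random_bits G)"
    if "v \<in> pverts G" for v
    using measurable_output_set[OF A wf G(2) that] by measurable
  show ?thesis
  proof (rule integral_ge_const)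
    have "integrable (random_bits G) (\<lambda>\<omega>. of_bool (v \<in> output_set A G p \<omega>) :: real)"
      if "v \<in> pverts G" for v
      by (rule integrable_const_bound[of _ 1]) (use m1[OF that] in auto)
    then show "integrable (random_bits G) (\<lambda>\<omega>. real (card (output_set A G p \<omega>)))"
      unfolding card_output_set_eq_sum[OF fin] by (rule Bochner_Integration.integrable_sum)
    show "AE \<omega> in random_bits G. real K \<le> real (card (output_set A G p \<omega>))"
      using cover by eventually_elim (simp add: K)
  qed
qed

section \<open>Two-lifts\<close>

definition graph_on :: "nat \<Rightarrow> (nat \<times> nat) set \<Rightarrow> nat pair_pre_digraph" where
  "graph_on N E = \<lparr>pverts = {..<N}, parcs = E\<rparr>"

lemma graph_on_simps [simp]: "pverts (graph_on N E) = {..<N}" "parcs (graph_on N E) = E"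
  by (simp_all add: graph_on_def)

lemma pair_graph_graph_on:
  assumes "sym E" "irrefl E" "E \<subseteq> {..<N} \<times> {..<N}"
  shows "pair_graph (graph_on N E)"
proof -
  have fin: "finite E" using assms(3) by (rule finite_subset) simp
  show ?thesis
  proof (unfold_locales, goal_cases)
    case 6
    then show ?case using assms(1) by (simp add: symmetric_def)
  qed (use assms fin in \<open>auto simp: irrefl_def\<close>)
qed

text \<open>
  The 2-lifts: vertex \<open>v\<close> has the copies \<open>2 * v\<close> and \<open>2 * v + 1\<close>. For even \<open>s\<close> the lift is two
  disjoint copies of the graph, for odd \<open>s\<close> it is the bipartite double cover.
\<close>

definition lift_arcs :: "nat \<Rightarrow> (nat \<times> nat) set \<Rightarrow> (nat \<times> nat) set" where
  "lift_arcs s E = {(x, y). (x div 2, y div 2) \<in> E \<and> even (x + y + s)}"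

definition lift_port :: "nat \<Rightarrow> (nat \<Rightarrow> nat \<Rightarrow> nat) \<Rightarrow> nat \<Rightarrow> nat \<Rightarrow> nat" where
  "lift_port s p x i = 2 * p (x div 2) i + (x + s) mod 2"

lemma pair_graph_lift:
  assumes "sym E" "irrefl E" "E \<subseteq> {..<n} \<times> {..<n}" "2 * n \<le> N"
  shows "pair_graph (graph_on N (lift_arcs s E))"
proof (rule pair_graph_graph_on)
  show "sym (lift_arcs s E)" using assms(1) by (auto simp: lift_arcs_def sym_def add_ac)
  show "irrefl (lift_arcs s E)" using assms(2) by (auto simp: lift_arcs_def irrefl_def)
  show "lift_arcs s E \<subseteq> {..<N} \<times> {..<N}"
  proof (clarsimp simp: lift_arcs_def)
    fix x y assume "(x div 2, y div 2) \<in> E"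
    then have "x div 2 < n" "y div 2 < n" using assms(3) by auto
    then show "x < N \<and> y < N" using assms(4) by linarith
  qed
qed

lemma neighbours_lift:
  "neighbours (graph_on N (lift_arcs s E)) x
     = (\<lambda>v. 2 * v + (x + s) mod 2) ` neighbours (graph_on N E) (x div 2)"
proof (intro equalityI subsetI)
  fix y assume "y \<in> neighbours (graph_on N (lift_arcs s E)) x"
  then have "(x div 2, y div 2) \<in> E" "even (x + y + s)" by (auto simp: neighbours_def lift_arcs_def)
  moreover from this(2) have "y = 2 * (y div 2) + (x + s) mod 2" by presburger
  ultimately show "y \<in> (\<lambda>v. 2 * v + (x + s) mod 2) ` neighbours (graph_on N E) (x div 2)"
    by (auto simp: neighbours_def intro!: image_eqI[of _ _ "y div 2"])
next
  fix y assume "y \<in> (\<lambda>v. 2 * v + (x + s) mod 2) ` neighbours (graph_on N E) (x div 2)"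
  then obtain v where v: "(x div 2, v) \<in> E" "y = 2 * v + (x + s) mod 2" by (auto simp: neighbours_def)
  have "y div 2 = v" "even (x + y + s)" unfolding v(2) by presburger+
  with v(1) show "y \<in> neighbours (graph_on N (lift_arcs s E)) x"
    by (auto simp: neighbours_def lift_arcs_def)
qed

lemma inj_double_plus: "inj_on (\<lambda>v. 2 * v + c) S" for c :: nat
  by (auto simp: inj_on_def)

lemma degree_lift:
  "degree_in (graph_on N (lift_arcs s E)) x = degree_in (graph_on N E) (x div 2)"
  unfolding neighbours_lift by (rule card_image[OF inj_double_plus])

lemma port_numbering_lift:
  assumes "port_numbering (graph_on N E) p"
  shows "port_numbering (graph_on N (lift_arcs s E)) (lift_port s p)"
  unfolding port_numbering_def
proof
  fix x assume "x \<in> pverts (graph_on N (lift_arcs s E))"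
  then have "x div 2 \<in> pverts (graph_on N E)" by auto
  then have "bij_betw (p (x div 2)) {..<degree_in (graph_on N E) (x div 2)} (neighbours (graph_on N E) (x div 2))"
    using assms by (auto simp: port_numbering_def)
  moreover have "bij_betw (\<lambda>v. 2 * v + (x + s) mod 2) (neighbours (graph_on N E) (x div 2))
      (neighbours (graph_on N (lift_arcs s E)) x)"
    unfolding neighbours_lift by (rule inj_on_imp_bij_betw[OF inj_double_plus])
  ultimately have "bij_betw ((\<lambda>v. 2 * v + (x + s) mod 2) \<circ> p (x div 2))
      {..<degree_in (graph_on N E) (x div 2)} (neighbours (graph_on N (lift_arcs s E)) x)"
    by (rule bij_betw_trans)
  then show "bij_betw (lift_port s p x) {..<degree_in (graph_on N (lift_arcs s E)) x}
      (neighbours (graph_on N (lift_arcs s E)) x)"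
    unfolding degree_lift by (simp add: lift_port_def comp_def cong: bij_betw_cong)
qed

lemma port_covering_lift:
  "port_covering (graph_on N (lift_arcs s E)) (lift_port s p) (graph_on N E) p (\<lambda>x. x div 2)"
  unfolding port_covering_def degree_lift by (auto simp: lift_port_def)

lemma walk_in_lift:
  "(x, y) \<in> lift_arcs s E ^^ k \<Longrightarrow> (x div 2, y div 2) \<in> E ^^ k \<and> even (x + y + k * s)"
proof (induction k arbitrary: y)
  case (Suc k)
  then obtain z where z: "(x, z) \<in> lift_arcs s E ^^ k" "(z, y) \<in> lift_arcs s E" by auto
  then have "(x div 2, z div 2) \<in> E ^^ k \<and> even (x + z + k * s)" using Suc.IH by simp
  moreover have "(z div 2, y div 2) \<in> E" "even (z + y + s)" using z(2) by (auto simp: lift_arcs_def)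
  ultimately show ?case by auto
qed auto

text \<open>Two vertices of the ball above one base vertex yield a closed base walk of length at
  most 2T. Each step changes the sheet by \<open>s\<close>, so if they differ, both \<open>s\<close>
  and the length of that walk are odd.\<close>

lemma inj_on_lift_ball:
  assumes "sym E" and no_odd: "odd s \<Longrightarrow> \<forall>q\<le>2 * T. odd q \<longrightarrow> (\<forall>v. (v, v) \<notin> E ^^ q)"
  shows "inj_on (\<lambda>x. x div 2) {y. \<exists>k\<le>T. (x, y) \<in> lift_arcs s E ^^ k}"
proof (rule inj_onI, clarify)
  fix y y' k k'
  assume eq: "y div 2 = y' div 2" and k: "k \<le> T" "k' \<le> T"
    and walks: "(x, y) \<in> lift_arcs s E ^^ k" "(x, y') \<in> lift_arcs s E ^^ k'"
  have E: "(x div 2, y div 2) \<in> E ^^ k" "(x div 2, y' div 2) \<in> E ^^ k'"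
    and par: "even (x + y + k * s)" "even (x + y' + k' * s)"
    using walk_in_lift walks by auto
  have closed: "(x div 2, x div 2) \<in> E ^^ (k + k')"
    using relpow_trans[OF E(1)] relpow_sym[OF assms(1) E(2)] eq by auto
  show "y = y'"
  proof (rule ccontr)
    assume "y \<noteq> y'"
    with eq have "odd (y + y')" by presburger
    moreover have "even ((y + y') + (k + k') * s)" using par by (auto simp: algebra_simps)
    ultimately have "odd s" "odd (k + k')" by auto
    moreover have "k + k' \<le> 2 * T" using k by linarith
    ultimately show False using no_odd closed by blast
  qed
qed

text \<open>For odd \<open>s\<close> every arc joins an even and an odd number, so the even copies
  form a cover. Padding vertices are isolated and cost nothing.\<close>

lemma vertex_cover_number_double_cover_le:
  assumes "E \<subseteq> {..<n} \<times> {..<n}" "2 * n \<le> N" "odd s"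
  shows "vertex_cover_number (graph_on N (lift_arcs s E)) \<le> n"
proof -
  let ?G = "graph_on N (lift_arcs s E)"
  let ?S = "(\<lambda>v. 2 * v) ` {..<n}"
  have "vertex_cover ?G ?S"
    unfolding vertex_cover_def
  proof (intro conjI ballI, goal_cases)
    case 1
    show ?case using assms(2) by auto
  next
    case (2 a)
    obtain x y where a: "a = (x, y)" by (cases a)
    with 2 have "(x div 2, y div 2) \<in> E" "even (x + y + s)" by (auto simp: lift_arcs_def)
    moreover have "z \<in> ?S" if "even z" "z div 2 < n" for z
      using that by (intro image_eqI[of _ _ "z div 2"]) auto
    ultimately show ?case using assms(1,3) a by auto
  qed
  moreover have "finite {S. vertex_cover ?G S}"
    by (rule finite_subset[of _ "Pow {..<N}"]) (auto simp: vertex_cover_def)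
  ultimately have "vertex_cover_number ?G \<le> card ?S"
    unfolding vertex_cover_number_def by (intro Min_le) auto
  also have "card ?S = n" by (simp add: card_image inj_on_def)
  finally show ?thesis .
qed

lemma vertex_cover_two_copies_card_ge:
  assumes "vertex_cover (graph_on N (lift_arcs 0 E)) S"
    and K: "\<And>S. (\<And>x y. (x, y) \<in> E \<Longrightarrow> x \<in> S \<or> y \<in> S) \<Longrightarrow> K \<le> card (S \<inter> {..<n})"
  shows "2 * K \<le> card S"
proof -
  define copy where "copy b = {v. 2 * v + b \<in> S} \<inter> {..<n}" for b
  have copy: "K \<le> card (copy b)" if "b < 2" for b
    unfolding copy_def
  proof (rule K)
    fix x y assume "(x, y) \<in> E"
    then have "(2 * x + b, 2 * y + b) \<in> lift_arcs 0 E" using that by (simp add: lift_arcs_def)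
    then show "x \<in> {v. 2 * v + b \<in> S} \<or> y \<in> {v. 2 * v + b \<in> S}"
      using assms(1) by (auto simp: vertex_cover_def)
  qed
  have finS: "finite S" using assms(1) by (auto simp: vertex_cover_def intro: finite_subset)
  let ?A = "(\<lambda>v. 2 * v + 0) ` copy 0" and ?B = "(\<lambda>v. 2 * v + 1) ` copy 1"
  have "2 * K \<le> card (copy 0) + card (copy 1)" using copy[of 0] copy[of 1] by simp
  also have "\<dots> = card ?A + card ?B" unfolding card_image[OF inj_double_plus] ..
  also have "\<dots> = card (?A \<union> ?B)"
  proof (rule card_Un_disjoint[symmetric])
    show "?A \<inter> ?B = {}" by (auto, presburger)
  qed (auto simp: copy_def)
  also have "\<dots> \<le> card S" by (rule card_mono[OF finS]) (auto simp: copy_def)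
  finally show ?thesis .
qed

text \<open>Both lifts have the same expected output size, a sum of acceptance probabilities of base
  vertices. Two copies force at least 2K; the double cover allows at most n + \<epsilon> N. The base
  graph merely supplies the common probabilities.\<close>

lemma approximation_gap_bound:
  assumes A: "randomized_algorithm A" "approximates_vertex_cover A \<epsilon>"
    and E: "sym E" "irrefl E" "E \<subseteq> {..<n} \<times> {..<n}" and N: "2 * n \<le> N"
    and K: "\<And>S. (\<And>x y. (x, y) \<in> E \<Longrightarrow> x \<in> S \<or> y \<in> S) \<Longrightarrow> K \<le> card (S \<inter> {..<n})"
    and no_odd: "\<And>q v. q \<le> 2 * T \<Longrightarrow> odd q \<Longrightarrow> (v, v) \<notin> E ^^ q"
    and dec: "\<And>(G :: nat pair_pre_digraph) p. pair_graph G \<Longrightarrow> card (pverts G) = N \<Longrightarrow>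
      port_numbering G p \<Longrightarrow> AE \<omega> in random_bits G. \<forall>v \<in> pverts G. decided_within A G p \<omega> T v"
  shows "2 * real K \<le> real n + \<epsilon> * real N"
proof -
  let ?G = "graph_on N E" and ?H = "\<lambda>s. graph_on N (lift_arcs s E)"
  have finE: "finite E" using E(3) by (rule finite_subset) simp
  have "\<forall>v. \<exists>f. bij_betw f {..<degree_in ?G v} (neighbours ?G v)"
  proof
    fix v
    have "finite (neighbours ?G v)"
      by (rule finite_subset[of _ "snd ` E"]) (use finE in \<open>auto simp: neighbours_def image_iff\<close>, force)
    from ex_bij_betw_nat_finite[OF this]
    show "\<exists>f. bij_betw f {..<degree_in ?G v} (neighbours ?G v)" by (simp add: atLeast0LessThan)
  qed
  then obtain p where p: "port_numbering ?G p" unfolding port_numbering_def by metis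
  note H = pair_graph_lift[OF E N] port_numbering_lift[OF p]
  define a where "a v = measure (random_bits ?G) {\<eta> \<in> space (random_bits ?G). accepts_within A ?G p T \<eta> v}" for v
  define ex where "ex s = (\<integral>\<omega>. real (card (output_set A (?H s) (lift_port s p) \<omega>)) \<partial>random_bits (?H s))" for s
  have ex: "ex s = (\<Sum>x<N. a (x div 2))" for s
  proof -
    have "ex s = (\<Sum>x\<in>pverts (?H s). measure (random_bits (?H s))
        {\<omega> \<in> space (random_bits (?H s)). accepts_within A (?H s) (lift_port s p) T \<omega> x})"
      unfolding ex_def by (intro expected_card_output_set A H dec) simp
    also have "\<dots> = (\<Sum>x<N. a (x div 2))"
    proof (rule sum.cong)
      fix x assume "x \<in> {..<N}"
      then show "measure (random_bits (?H s))
        {\<omega> \<in> space (random_bits (?H s)). accepts_within A (?H s) (lift_port s p) T \<omega> x} = a (x div 2)"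
        unfolding a_def using inj_on_lift_ball[OF E(1), of s T] no_odd
        by (intro prob_accepts_within_covering[OF A(1) H p port_covering_lift]) auto
    qed simp
    finally show ?thesis .
  qed
  have "real (2 * K) \<le> ex 0"
    unfolding ex_def
  proof (rule expected_card_output_set_ge[OF A(1) H])
    show "AE \<omega> in random_bits (?H 0). vertex_cover (?H 0) (output_set A (?H 0) (lift_port 0 p) \<omega>)"
      using A(2) H[of 0] unfolding approximates_vertex_cover_def by fastforce
    show "2 * K \<le> card S" if "vertex_cover (?H 0) S" for S
      using that K by (rule vertex_cover_two_copies_card_ge)
  qed
  also have "ex 0 = ex 1" by (simp only: ex)
  also have "ex 1 \<le> real (vertex_cover_number (?H 1)) + \<epsilon> * real (card (pverts (?H 1)))"
    using A(2) H[of 1] unfolding approximates_vertex_cover_def ex_def by blast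
  also have "\<dots> \<le> real n + \<epsilon> * real N"
    using vertex_cover_number_double_cover_le[OF E(3) N, of 1] by simp
  finally show ?thesis by simp
qed

section \<open>The lower bound\<close>

lemma Inf_enat_mem: "X \<noteq> {} \<Longrightarrow> Inf X \<in> X" for X :: "enat set"
  unfolding Inf_enat_def by (auto intro: LeastI)

text \<open>A finite infimum in \<open>enat\<close> is attained, so it is itself an admissible
  number of rounds \<open>T\<close>; the infinite case is trivial.\<close>

lemma round_complexity_geI:
  assumes "\<And>T. (\<And>(G :: nat pair_pre_digraph) p. pair_graph G \<Longrightarrow> card (pverts G) = n \<Longrightarrow> port_numbering G p \<Longrightarrow>
      AE \<omega> in random_bits G. \<forall>v \<in> pverts G. decided_within A G p \<omega> T v) \<Longrightarrow> x \<le> real T"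
  shows "ereal x \<le> ereal_of_enat (round_complexity A n)"
proof (cases "round_complexity A n")
  case (enat T)
  let ?X = "{enat T | T. \<forall>(G :: nat pair_pre_digraph) p.
       pair_graph G \<and> card (pverts G) = n \<and> port_numbering G p \<longrightarrow>
         (AE \<omega> in random_bits G. \<forall>v \<in> pverts G. decided_within A G p \<omega> T v)}"
  have "?X \<noteq> {}" using enat by (auto simp: round_complexity_def Inf_enat_def split: if_splits)
  then have "Inf ?X \<in> ?X" by (rule Inf_enat_mem)
  then have "enat T \<in> ?X" using enat unfolding round_complexity_def by (simp only:)
  then have "x \<le> real T" by (intro assms) auto
  then show ?thesis by (simp add: enat)
qed simp

text \<open>A copy has n' <= n (64k + 1) vertices and needs at least 7n/10 + km of them in a cover,
  n/5 more than half. Two copies make a gap of 2n/5, which the error \<epsilon> N has to absorb. The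
  second condition on \<open>L\<close> excludes odd closed walks of length at most 2T.\<close>

lemma small_round_complexity_contradiction:
  assumes A: "randomized_algorithm A" "approximates_vertex_cover A \<epsilon>"
    and dec: "\<And>(G :: nat pair_pre_digraph) p. pair_graph G \<Longrightarrow> card (pverts G) = N \<Longrightarrow>
      port_numbering G p \<Longrightarrow> AE \<omega> in random_bits G. \<forall>v \<in> pverts G. decided_within A G p \<omega> T v"
    and n: "80 * 64 ^ L \<le> n" "2 * (n * (64 * k + 1)) \<le> N"
    and L: "3 \<le> L" "2 * T + 2 * (2 * k + 1) \<le> L * (2 * k + 1)"
  shows "2 * real n \<le> 5 * \<epsilon> * real N"
proof -
  obtain m and g :: "nat \<Rightarrow> nat \<times> nat" where m: "m \<le> 32 * n" and g: "g ` {..<m} \<subseteq> {..<n} \<times> {..<n}"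
    and sparse: "\<And>U. U \<subseteq> {..<n} \<Longrightarrow> 10 * card U \<le> 3 * n + 10 * card {i. i < m \<and> g i \<in> U \<times> U}"
    and girth: "\<And>q x. q \<le> L \<Longrightarrow> odd q \<Longrightarrow> (x, x) \<notin> edge_arcs g {..<m} ^^ q"
    by (rule exists_sparse_graph_large_odd_girth_small_independence[OF n(1)]) (rule that)
  define E where "E = subdivision n k m g"
  define n' where "n' = n + 2 * k * m"
  have E_sub: "E \<subseteq> {..<n'} \<times> {..<n'}" unfolding E_def n'_def by (rule subdivision_subset[OF g])
  have E_odd: "(v, v) \<notin> E ^^ q" if q: "q + 2 * (2 * k + 1) \<le> L * (2 * k + 1)" "odd q" for q v
  proof
    assume walk: "(v, v) \<in> E ^^ q"
    obtain r u where r: "odd r" "r * (2 * k + 1) \<le> q + 2 * (2 * k + 1)" "(u, u) \<in> edge_arcs g {..<m} ^^ r"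
      by (rule odd_closed_walk_of_subdivision[OF g walk[unfolded E_def] q(2)]) (rule that)
    have "r * (2 * k + 1) \<le> L * (2 * k + 1)" using r(2) q(1) by (rule order_trans)
    then have "r \<le> L" by (simp only: mult_le_cancel2)
    with r girth show False by blast
  qed
  have irr: "irrefl E"
  proof (rule irreflI)
    fix x
    \<comment> \<open>A loop is an odd closed walk of length 1; \<open>L(1)\<close> leaves just
      enough room to exclude it.\<close>
    have "1 + 2 * (2 * k + 1) \<le> 3 * (2 * k + 1)" by simp
    also have "\<dots> \<le> L * (2 * k + 1)" using L(1) by (rule mult_right_mono) simp
    finally show "(x, x) \<notin> E" using E_odd[of 1 x] by auto
  qed
  \<comment> \<open>The bound 7n/10 + km, rounded up.\<close>
  define K where "K = (7 * n + 10 * (k * m) + 9) div 10"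
  have cover: "K \<le> card (S \<inter> {..<n'})" if S: "\<And>x y. (x, y) \<in> E \<Longrightarrow> x \<in> S \<or> y \<in> S" for S
  proof -
    let ?U = "{..<n} - S"
    have "card (S \<inter> {..<n}) + k * m + card {i. i < m \<and> g i \<in> ?U \<times> ?U} \<le> card (S \<inter> {..<n'})"
      unfolding n'_def by (rule subdivision_cover_card_ge[OF g]) (use S in \<open>auto simp: E_def\<close>)
    moreover have "10 * card ?U \<le> 3 * n + 10 * card {i. i < m \<and> g i \<in> ?U \<times> ?U}"
      by (rule sparse) auto
    moreover have "card ?U + card (S \<inter> {..<n}) = n"
    proof -
      have "card ?U + card (S \<inter> {..<n}) = card (?U \<union> (S \<inter> {..<n}))"
        by (rule card_Un_disjoint[symmetric]) auto
      also have "?U \<union> (S \<inter> {..<n}) = {..<n}" by auto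
      finally show ?thesis by simp
    qed
    ultimately have "7 * n + 10 * (k * m) \<le> 10 * card (S \<inter> {..<n'})" by linarith
    then show ?thesis unfolding K_def by linarith
  qed
  define a b where "a = k * m" and "b = k * n"
  have "a \<le> 32 * b" using mult_left_mono[OF m, of k] by (simp add: a_def b_def mult.left_commute)
  moreover have "2 * (64 * b + n) \<le> N" using n(2) by (simp add: b_def algebra_simps)
  moreover have "n' = n + 2 * a" by (simp add: n'_def a_def)
  ultimately have "2 * n' \<le> N" by simp
  moreover have "sym E" unfolding E_def by (rule sym_subdivision)
  ultimately have "2 * real K \<le> real n' + \<epsilon> * real N"
    using L(2) by (intro approximation_gap_bound[OF A _ irr E_sub _ cover E_odd dec]) auto
  moreover have "7 * n + 10 * (k * m) \<le> 10 * K" unfolding K_def by linarith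
  then have "7 * real n + 10 * real (k * m) \<le> 10 * real K" by linarith
  moreover have "real n' = real n + 2 * real (k * m)" by (simp add: n'_def)
  ultimately show ?thesis by linarith
qed

theorem theoremB4:
  shows "\<exists>c::real. c > 0 \<and>
    (\<forall>\<epsilon>::real. 0 < \<epsilon> \<and> \<epsilon> \<le> 0.04 \<longrightarrow>
      (\<exists>n0::nat. \<forall>A. randomized_algorithm A \<and> approximates_vertex_cover A \<epsilon> \<longrightarrow>
        (\<forall>n\<ge>n0. ereal (c * ln (real n) / \<epsilon>) \<le> ereal_of_enat (round_complexity A n))))"
proof (intro exI[of _ "1 / 48000"] conjI allI impI)
  fix \<epsilon> :: real
  assume \<epsilon>: "0 < \<epsilon> \<and> \<epsilon> \<le> 0.04"
  \<comment> \<open>The 1200 gives \<epsilon> M <= 64/1200 + 0.04 < 0.0934, below the 1/10 at which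
    the final comparison would fail. For \<epsilon> > 1/1200 this \<open>k\<close> is 0 and nothing
    is subdivided.\<close>
  define k where "k = nat \<lfloor>1 / (1200 * \<epsilon>)\<rfloor>"
  define M where "M = 64 * k + 1"
  have k_le: "real k \<le> 1 / (1200 * \<epsilon>)" using \<epsilon> by (simp add: k_def of_nat_floor)
  have k_ge: "1 / (1200 * \<epsilon>) \<le> real k + 1" unfolding k_def by linarith
  have \<epsilon>M: "\<epsilon> * real M \<le> 0.0934"
  proof -
    have "\<epsilon> * real k \<le> 1 / 1200" using k_le \<epsilon> by (simp add: field_simps)
    then show ?thesis using \<epsilon> by (simp add: M_def algebra_simps)
  qed
  have ln64: "ln (64 :: real) \<le> 5"
  proof -
    have "ln (64 :: real) = 6 * ln 2" using ln_realpow[of "2::real" 6] by simp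
    then show ?thesis using ln2_le_25_over_36 by simp
  qed
  have ln64_pos: "0 < ln (64 :: real)" by simp
  show "\<exists>n0::nat. \<forall>A. randomized_algorithm A \<and> approximates_vertex_cover A \<epsilon> \<longrightarrow>
      (\<forall>n\<ge>n0. ereal (1 / 48000 * ln (real n) / \<epsilon>) \<le> ereal_of_enat (round_complexity A n))"
  \<comment> \<open>The square makes \<open>ln (320 * real M)\<close> cost at most half of
    \<open>ln (real N)\<close>, and \<open>exp 20\<close> pays for the additive terms in the bound
    on \<open>L\<close>. The 320 M is 80 from the base graph times 4 M from n >= N / (4 M).\<close>
  proof (intro exI[of _ "nat \<lceil>exp 20 * (320 * real M)\<^sup>2\<rceil>"] allI impI)
    fix A and N :: nat
    assume A: "randomized_algorithm A \<and> approximates_vertex_cover A \<epsilon>"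
      and N: "nat \<lceil>exp 20 * (320 * real M)\<^sup>2\<rceil> \<le> N"
    have M1: "1 \<le> real M" by (simp add: M_def)
    have N_ge: "exp 20 * (320 * real M)\<^sup>2 \<le> real N" using N by linarith
    have "ln (exp 20 * (320 * real M)\<^sup>2) \<le> ln (real N)"
      using N_ge M1 by (intro ln_mono) auto
    moreover have "ln (exp 20 * x\<^sup>2) = 20 + 2 * ln x" if "0 < x" for x :: real
      using that by (simp add: ln_mult ln_realpow)
    from this[of "320 * real M"] have "ln (exp 20 * (320 * real M)\<^sup>2) = 20 + 2 * ln (320 * real M)"
      using M1 by linarith
    ultimately have lnN: "20 + 2 * ln (320 * real M) \<le> ln (real N)" by linarith
    have M_pos: "0 \<le> ln (320 * real M)" using M1 by simp
    have "1 * (320 * real M) \<le> exp 20 * (320 * real M)\<^sup>2"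
      unfolding power2_eq_square using M1 by (intro mult_mono) (auto intro: order_trans[OF M1])
    then have N_big: "320 * real M \<le> real N" using N_ge by linarith
    define n where "n = N div (2 * M)"
    have n_le: "2 * (n * M) \<le> N" unfolding n_def
      by (metis div_times_less_eq_dividend mult.assoc mult.commute)
    have "0 < 2 * M" by (simp add: M_def)
    from dividend_less_times_div[OF this, of N] have "N < 2 * M + 2 * M * n" unfolding n_def .
    then have "real N < real (2 * M + 2 * M * n)" by (simp only: of_nat_less_iff)
    then have N_less: "real N < 2 * real M * (real n + 1)" by (simp add: algebra_simps)
    have n1: "1 \<le> real n"
    proof (rule ccontr)
      assume "\<not> ?thesis"
      then have "n = 0" by simp
      with N_less N_big M1 show False by simp
    qed
    have "2 * real M * (real n + 1) \<le> 2 * real M * (2 * real n)" using n1 M1 by (intro mult_left_mono) auto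
    with N_less have "real N \<le> 2 * real M * (2 * real n)" by linarith
    then have n_ge: "real N / (320 * real M) \<le> real n / 80"
      using M1 by (simp add: field_simps)
    define L where "L = nat \<lfloor>ln (real n / 80) / ln 64\<rfloor>"
    have "ln (real N) - ln (320 * real M) = ln (real N / (320 * real M))"
      using N_big M1 by (subst ln_div) auto
    also have "\<dots> \<le> ln (real n / 80)"
      using n_ge N_big M1 by (intro ln_mono) auto
    finally have ln_n: "ln (real N) - ln (320 * real M) \<le> ln (real n / 80)" .
    have ln_n_pos: "0 \<le> ln (real n / 80)" using ln_n lnN M_pos by linarith
    have L_le: "real L \<le> ln (real n / 80) / ln 64"
      using ln_n_pos ln64_pos unfolding L_def by (intro of_nat_floor) simp
    have "ln (real n / 80) / 5 \<le> ln (real n / 80) / ln 64"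
      using ln64 ln64_pos ln_n_pos by (intro divide_left_mono) auto
    also have "\<dots> \<le> real L + 1" unfolding L_def by linarith
    \<comment> \<open>The bounds give L >= ln N / 10 + 1, and ln N >= 20 turns half of the first
      term into the missing 1. The summand 2 covers the slack 2(2k + 1) of the subdivision.\<close>
    finally have L_ge: "ln (real N) / 20 + 2 \<le> real L" using ln_n lnN M_pos by linarith
    then have L3: "3 \<le> L" using lnN M_pos by linarith
    have "64 ^ L = exp (real L * ln (64::real))" by (simp add: exp_of_nat_mult)
    also have "\<dots> \<le> exp (ln (real n / 80))"
      using L_le ln64_pos by (simp add: pos_le_divide_eq)
    also have "\<dots> = real n / 80" using n1 by simp
    finally have "real (80 * 64 ^ L) \<le> real n" by simp
    then have Ln: "80 * 64 ^ L \<le> n" by (simp only: of_nat_le_iff)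
    show "ereal (1 / 48000 * ln (real N) / \<epsilon>) \<le> ereal_of_enat (round_complexity A N)"
    proof (rule round_complexity_geI, rule ccontr)
      fix T
      assume dec: "\<And>(G :: nat pair_pre_digraph) p. pair_graph G \<Longrightarrow> card (pverts G) = N \<Longrightarrow> port_numbering G p \<Longrightarrow>
          AE \<omega> in random_bits G. \<forall>v \<in> pverts G. decided_within A G p \<omega> T v"
        and "\<not> 1 / 48000 * ln (real N) / \<epsilon> \<le> real T"
      \<comment> \<open>Here 48000 = 2 * 20 * 1200: closed walks up to length 2T matter,
        \<open>L\<close> is at least ln N / 20, and \<open>k\<close> is about 1 / (1200
        \<epsilon>).\<close>
      then have "2 * real T \<le> (ln (real N) / 20) * (1 / (1200 * \<epsilon>))" by simp
      also have "\<dots> \<le> (ln (real N) / 20) * (2 * real k + 1)"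
        using k_ge lnN M_pos by (intro mult_left_mono) auto
      finally have "2 * real T + 2 * (2 * real k + 1) \<le> (ln (real N) / 20 + 2) * (2 * real k + 1)"
        by (simp add: algebra_simps)
      also have "\<dots> \<le> real L * (2 * real k + 1)" using L_ge by (rule mult_right_mono) simp
      finally have "real (2 * T + 2 * (2 * k + 1)) \<le> real (L * (2 * k + 1))"
        by (simp add: algebra_simps)
      then have TL: "2 * T + 2 * (2 * k + 1) \<le> L * (2 * k + 1)" by (simp only: of_nat_le_iff)
      have "2 * real n \<le> 5 * \<epsilon> * real N"
        using A n_le unfolding M_def
        by (intro small_round_complexity_contradiction[OF _ _ dec Ln _ L3 TL]) auto
      \<comment> \<open>Rounding N down to a multiple of 2M turns n into n + 1. This is affordable,
        since n >= 1 gives 0.934 (n + 1) <= 1.868 n < 2n.\<close>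
      also have "\<dots> \<le> 5 * \<epsilon> * (2 * real M * (real n + 1))"
        using N_less \<epsilon> by (intro mult_left_mono) auto
      also have "\<dots> = 10 * (\<epsilon> * real M) * (real n + 1)" by simp
      also have "\<dots> \<le> 0.934 * (real n + 1)" using \<epsilon>M by (intro mult_right_mono) auto
      finally show False using n1 by simp
    qed
  qed
qed simp

end
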